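(* (a) Fix $n>0$. For any relational signature $\Sigma$ and any set $Q$ of $\mathcal{EL}(\Sigma)$-queries with $|Q|\le n$, one can compute in polynomial time a split partner $\mathcal S(Q)$ of $Q$ in $\mathcal{EL}(\Sigma)$. (b) For any finite set $Q$ of $\mathcal{ELI}(\Sigma)$-queries, one can compute in exponential time a split partner of $Q$ in $\mathcal{ELI}(\Sigma)$. (c) Even for singleton sets $Q$ of $\mathcal{ELI}(\Sigma)$-queries, no polynomial-size split partner of $Q$ in $\mathcal{ELI}(\Sigma)$ exists in general: there is no polynomial $f$ such that for every relational signature $\Sigma$ and every $\mathcal{ELI}(\Sigma)$-query $q$ there is a split partner of $\{q\}$ in $\mathcal{ELI}(\Sigma)$ of total size at most $f(|q|+|\Sigma|)$.
   Context: A relational signature $\Sigma$ is a finite nonempty set of unary and binary predicate symbols. A $\Sigma$-data instance $\mathcal A$ is a finite set of facts $A(a)$, $P(a,b)$ with $A,P\in\Sigma$ and individual names $a,b$; $P^-(a,b)\in\mathcal A$ means $P(b,a)\in\mathcal A$. A pointed $\Sigma$-data instance is a pair $(\mathcal A,a)$ with $a$ an individual name of $\mathcal A$. $\mathcal{ELI}(\Sigma)$-queries are built from $\top$ and unary symbols of $\Sigma$ using $\wedge$ and $\exists S.q$, where $S$ is $P$ or $P^-$ for a binary $P\in\Sigma$; $\mathcal{EL}(\Sigma)$-queries are those without inverses $P^-$. $\mathcal A\models q(a)$ is defined by: $\mathcal A\models A(a)$ iff $A(a)\in\mathcal A$; $\mathcal A\models(\exists S.q)(a)$ iff $S(a,b)\in\mathcal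 A$ and $\mathcal A\models q(b)$ for some $b$; $\top,\wedge$ as usual. $q'\models q$ means that $\mathcal A\models q'(a)$ implies $\mathcal A\models q(a)$ for all pointed $(\mathcal A,a)$. $|q|$ is the number of symbols in $q$. For $\mathcal L\in\{\mathcal{EL},\mathcal{ELI}\}$ and a finite set $Q$ of $\mathcal L(\Sigma)$-queries, a finite set $\mathcal S(Q)$ of pointed $\Sigma$-data instances is a split partner of $Q$ in $\mathcal L(\Sigma)$ if for all $\mathcal L(\Sigma)$-queries $q'$ the following are equivalent: (1) $\mathcal A\models q'(a)$ for some $(\mathcal A,a)\in\mathcal S(Q)$; (2) $q'\not\models q$ for all $q\in Q$. Its total size is the total number of facts in its members. Polynomial/exponential time is measured in the total size of $Q$ and $\Sigma$.
   Formalization: The distinguished name a of a pointed data instance (A,a) may be any individual name, even one in no fact of A; if a must occur in A, the claim fails, e.g. for unary A, B with Σ = Q = {A, B}, where ⊤ entails neither query but every individual satisfies one. *)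

theory Defs
  imports Main "HOL-Computational_Algebra.Polynomial"
begin

section \<open>Signatures, data instances and queries\<close>

text \<open>Predicate and individual names are words over a two-letter alphabet: an infinite supply of
  names, each of which has an honest length when it is handed to an algorithm.\<close>

type_synonym name = "bool list"

datatype predicate = Unary name | Binary name

type_synonym signature = "predicate set"

definition is_signature :: "signature \<Rightarrow> bool" where
  "is_signature \<Sigma> \<longleftrightarrow> finite \<Sigma> \<and> \<Sigma> \<noteq> {}"

datatype fact = UFact name name | BFact name name name

fun fact_pred :: "fact \<Rightarrow> predicate" where
  "fact_pred (UFact A a) = Unary A"
| "fact_pred (BFact P a b) = Binary P"

definition data_instance :: "fact set \<Rightarrow> bool" where
  "data_instance \<A> \<longleftrightarrow> finite \<A>"

definition data_instance_over :: "signature \<Rightarrow> fact set \<Rightarrow> bool" where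
  "data_instance_over \<Sigma> \<A> \<longleftrightarrow> data_instance \<A> \<and> fact_pred ` \<A> \<subseteq> \<Sigma>"

text \<open>The distinguished individual of a pointed data instance may be one about which the instance
  states no fact (as if the trivial facts \<open>\<top>(a)\<close> were admitted in data instances). Without this,
  split partners need not exist: over two unary symbols \<open>A\<close> and \<open>B\<close> only, the query \<open>\<top>\<close> entails
  neither \<open>A\<close> nor \<open>B\<close>, but every individual that occurs in an instance satisfies one of them, so
  \<open>{A, B}\<close> would have no split partner.\<close>

type_synonym pointed = "fact set \<times> name"

datatype role = Fwd name | Inv name

fun role_pred :: "role \<Rightarrow> predicate" where
  "role_pred (Fwd P) = Binary P"
| "role_pred (Inv P) = Binary P"

fun role_holds :: "fact set \<Rightarrow> role \<Rightarrow> name \<Rightarrow> name \<Rightarrow> bool" where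
  "role_holds \<A> (Fwd P) a b \<longleftrightarrow> BFact P a b \<in> \<A>"
| "role_holds \<A> (Inv P) a b \<longleftrightarrow> BFact P b a \<in> \<A>"

datatype query = Top | Atom name | And query query | Ex role query

fun preds :: "query \<Rightarrow> predicate set" where
  "preds Top = {}"
| "preds (Atom A) = {Unary A}"
| "preds (And q1 q2) = preds q1 \<union> preds q2"
| "preds (Ex S q) = insert (role_pred S) (preds q)"

fun inverse_free :: "query \<Rightarrow> bool" where
  "inverse_free Top \<longleftrightarrow> True"
| "inverse_free (Atom A) \<longleftrightarrow> True"
| "inverse_free (And q1 q2) \<longleftrightarrow> inverse_free q1 \<and> inverse_free q2"
| "inverse_free (Ex S q) \<longleftrightarrow> (\<exists>P. S = Fwd P) \<and> inverse_free q"

definition ELI :: "signature \<Rightarrow> query set" where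
  "ELI \<Sigma> = {q. preds q \<subseteq> \<Sigma>}"

definition EL :: "signature \<Rightarrow> query set" where
  "EL \<Sigma> = {q \<in> ELI \<Sigma>. inverse_free q}"

fun query_size :: "query \<Rightarrow> nat" where
  "query_size Top = 1"
| "query_size (Atom A) = 1"
| "query_size (And q1 q2) = query_size q1 + 1 + query_size q2"
| "query_size (Ex S q) = 2 + query_size q"

fun sat :: "fact set \<Rightarrow> query \<Rightarrow> name \<Rightarrow> bool" where
  "sat \<A> Top a \<longleftrightarrow> True"
| "sat \<A> (Atom A) a \<longleftrightarrow> UFact A a \<in> \<A>"
| "sat \<A> (And q1 q2) a \<longleftrightarrow> sat \<A> q1 a \<and> sat \<A> q2 a"
| "sat \<A> (Ex S q) a \<longleftrightarrow> (\<exists>b. role_holds \<A> S a b \<and> sat \<A> q b)"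

definition entails :: "query \<Rightarrow> query \<Rightarrow> bool" where
  "entails q' q \<longleftrightarrow> (\<forall>\<A> a. data_instance \<A> \<longrightarrow> sat \<A> q' a \<longrightarrow> sat \<A> q a)"

definition split_partner ::
  "(signature \<Rightarrow> query set) \<Rightarrow> signature \<Rightarrow> query set \<Rightarrow> pointed set \<Rightarrow> bool" where
  "split_partner L \<Sigma> Q \<S> \<longleftrightarrow>
     finite \<S> \<and> (\<forall>(\<A>, a) \<in> \<S>. data_instance_over \<Sigma> \<A>) \<and>
     (\<forall>q' \<in> L \<Sigma>. (\<exists>(\<A>, a) \<in> \<S>. sat \<A> q' a) \<longleftrightarrow> (\<forall>q \<in> Q. \<not> entails q' q))"

definition total_size :: "pointed set \<Rightarrow> nat" where
  "total_size \<S> = (\<Sum>(\<A>, a) \<in> \<S>. card \<A>)"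


section \<open>Computation\<close>

text \<open>The machine model is a first-order, call-by-value functional language over binary trees.
  A program is a list of function bodies; the arguments of a call are accessed by position.
  Every evaluation step is charged, and reading a variable is charged the size of the value that
  is copied. Hence the cost bounds the size of every value built (lemma \<open>eval_cost_ge_size\<close>), no
  exponentially large value can be created cheaply by sharing, and the model and Turing machines
  simulate each other with polynomial overhead.\<close>

datatype tree = Lf | Nd tree tree

fun tree_size :: "tree \<Rightarrow> nat" where
  "tree_size Lf = 1"
| "tree_size (Nd s t) = 1 + tree_size s + tree_size t"

fun left :: "tree \<Rightarrow> tree" where
  "left Lf = Lf"
| "left (Nd s t) = s"

fun right :: "tree \<Rightarrow> tree" where
  "right Lf = Lf"
| "right (Nd s t) = t"

fun enc_bool :: "bool \<Rightarrow> tree" where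
  "enc_bool False = Lf"
| "enc_bool True = Nd Lf Lf"

datatype expr =
    Var nat
  | LfE
  | NdE expr expr
  | LeftE expr
  | RightE expr
  | EqE expr expr
  | IfE expr expr expr
  | Call nat "expr list"

type_synonym program = "expr list"

inductive eval :: "program \<Rightarrow> tree list \<Rightarrow> expr \<Rightarrow> tree \<Rightarrow> nat \<Rightarrow> bool" for p :: program where
  eval_Var: "i < length env \<Longrightarrow> eval p env (Var i) (env ! i) (1 + tree_size (env ! i))"
| eval_Lf: "eval p env LfE Lf 1"
| eval_Nd: "eval p env e1 v1 t1 \<Longrightarrow> eval p env e2 v2 t2 \<Longrightarrow>
    eval p env (NdE e1 e2) (Nd v1 v2) (1 + t1 + t2)"
| eval_Left: "eval p env e v t \<Longrightarrow> eval p env (LeftE e) (left v) (1 + t)"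
| eval_Right: "eval p env e v t \<Longrightarrow> eval p env (RightE e) (right v) (1 + t)"
| eval_Eq: "eval p env e1 v1 t1 \<Longrightarrow> eval p env e2 v2 t2 \<Longrightarrow>
    eval p env (EqE e1 e2) (enc_bool (v1 = v2)) (2 + t1 + t2)"
| eval_If_then: "eval p env e0 v0 t0 \<Longrightarrow> v0 \<noteq> Lf \<Longrightarrow> eval p env e1 v1 t1 \<Longrightarrow>
    eval p env (IfE e0 e1 e2) v1 (1 + t0 + t1)"
| eval_If_else: "eval p env e0 v0 t0 \<Longrightarrow> v0 = Lf \<Longrightarrow> eval p env e2 v2 t2 \<Longrightarrow>
    eval p env (IfE e0 e1 e2) v2 (1 + t0 + t2)"
| eval_Call: "f < length p \<Longrightarrow> length vs = length es \<Longrightarrow> length ts = length es \<Longrightarrow>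
    (\<forall>i < length es. eval p env (es ! i) (vs ! i) (ts ! i)) \<Longrightarrow> eval p vs (p ! f) v t \<Longrightarrow>
    eval p env (Call f es) v (1 + sum_list ts + t)"

lemma eval_cost_ge_size: "eval p env e v t \<Longrightarrow> tree_size v \<le> t"
proof (induction rule: eval.induct)
  case (eval_Left env e v t)
  then show ?case by (cases v) auto
next
  case (eval_Right env e v t)
  then show ?case by (cases v) auto
next
  case (eval_Eq env e1 v1 t1 e2 v2 t2)
  have "tree_size v1 \<ge> 1" by (cases v1) auto
  with eval_Eq show ?case by (cases "v1 = v2") auto
qed auto

inductive_cases eval_VarE: "eval p env (Var i) v t"
inductive_cases eval_LfE: "eval p env LfE v t"
inductive_cases eval_NdE: "eval p env (NdE e1 e2) v t"
inductive_cases eval_LeftE: "eval p env (LeftE e) v t"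
inductive_cases eval_RightE: "eval p env (RightE e) v t"
inductive_cases eval_EqE: "eval p env (EqE e1 e2) v t"
inductive_cases eval_IfE: "eval p env (IfE e0 e1 e2) v t"
inductive_cases eval_CallE: "eval p env (Call f es) v t"

lemma eval_deterministic:
  "eval p env e v t \<Longrightarrow> eval p env e v' t' \<Longrightarrow> v' = v \<and> t' = t"
proof (induction arbitrary: v' t' rule: eval.induct)
  case eval_Var
  from eval_Var.prems show ?case by (rule eval_VarE) simp
next
  case eval_Lf
  from eval_Lf.prems show ?case by (rule eval_LfE) simp
next
  case eval_Nd
  from eval_Nd.prems show ?case by (rule eval_NdE) (auto dest!: eval_Nd.IH)
next
  case eval_Left
  from eval_Left.prems show ?case by (rule eval_LeftE) (auto dest!: eval_Left.IH)
next
  case eval_Right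
  from eval_Right.prems show ?case by (rule eval_RightE) (auto dest!: eval_Right.IH)
next
  case eval_Eq
  from eval_Eq.prems show ?case by (rule eval_EqE) (auto dest!: eval_Eq.IH)
next
  case eval_If_then
  from eval_If_then.prems show ?case
    by (rule eval_IfE) (use eval_If_then.hyps in \<open>auto dest!: eval_If_then.IH\<close>)
next
  case eval_If_else
  from eval_If_else.prems show ?case
    by (rule eval_IfE) (use eval_If_else.hyps in \<open>auto dest!: eval_If_else.IH\<close>)
next
  case (eval_Call f vs es ts env v t)
  from eval_Call.prems show ?case
  proof (rule eval_CallE)
    fix vs' ts' u
    assume *: "t' = Suc (sum_list ts' + u)" "length vs' = length es" "length ts' = length es"
      "\<forall>i < length es. eval p env (es ! i) (vs' ! i) (ts' ! i)" "eval p vs' (p ! f) v' u"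
    have "vs' ! i = vs ! i \<and> ts' ! i = ts ! i" if "i < length es" for i
      using * eval_Call.IH(1) that by blast
    then have "vs' = vs" "ts' = ts"
      using *(2,3) eval_Call.hyps by (simp_all add: list_eq_iff_nth_eq)
    moreover from this have "v' = v" "u = t" using *(5) eval_Call.IH(2) by auto
    ultimately show ?thesis using *(1) by simp
  qed
qed

text \<open>The program \<open>p\<close>, started with function number 0 on input \<open>x\<close>, terminates with output \<open>y\<close> and
  cost \<open>t\<close>.\<close>

definition runs :: "program \<Rightarrow> tree \<Rightarrow> tree \<Rightarrow> nat \<Rightarrow> bool" where
  "runs p x y t \<longleftrightarrow> eval p [x] (Call 0 [Var 0]) y t"


section \<open>Encoding of inputs and outputs\<close>

definition enc_list :: "('a \<Rightarrow> tree) \<Rightarrow> 'a list \<Rightarrow> tree" where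
  "enc_list f xs = foldr (\<lambda>x t. Nd (f x) t) xs Lf"

definition enc_name :: "name \<Rightarrow> tree" where
  "enc_name = enc_list enc_bool"

definition enc_tag :: "nat \<Rightarrow> tree" where
  "enc_tag k = ((\<lambda>t. Nd Lf t) ^^ k) Lf"

fun enc_predicate :: "predicate \<Rightarrow> tree" where
  "enc_predicate (Unary A) = Nd (enc_tag 0) (enc_name A)"
| "enc_predicate (Binary P) = Nd (enc_tag 1) (enc_name P)"

fun enc_role :: "role \<Rightarrow> tree" where
  "enc_role (Fwd P) = Nd (enc_tag 0) (enc_name P)"
| "enc_role (Inv P) = Nd (enc_tag 1) (enc_name P)"

fun enc_query :: "query \<Rightarrow> tree" where
  "enc_query Top = Nd (enc_tag 0) Lf"
| "enc_query (Atom A) = Nd (enc_tag 1) (enc_name A)"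
| "enc_query (And q1 q2) = Nd (enc_tag 2) (Nd (enc_query q1) (enc_query q2))"
| "enc_query (Ex S q) = Nd (enc_tag 3) (Nd (enc_role S) (enc_query q))"

fun enc_fact :: "fact \<Rightarrow> tree" where
  "enc_fact (UFact A a) = Nd (enc_tag 0) (Nd (enc_name A) (enc_name a))"
| "enc_fact (BFact P a b) = Nd (enc_tag 1) (Nd (enc_name P) (Nd (enc_name a) (enc_name b)))"

definition enc_pointed :: "fact list \<times> name \<Rightarrow> tree" where
  "enc_pointed = (\<lambda>(fs, a). Nd (enc_list enc_fact fs) (enc_name a))"

text \<open>Finite sets are presented to a program as lists without repetitions, in any order.
  The size of such an input is, up to a constant factor, the number of symbols in \<open>\<Sigma>\<close> and \<open>Q\<close>
  with each occurrence of a predicate counted with the length of its name.\<close>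

definition encodes_input :: "signature \<Rightarrow> query set \<Rightarrow> tree \<Rightarrow> bool" where
  "encodes_input \<Sigma> Q x \<longleftrightarrow>
     (\<exists>ps qs. distinct ps \<and> set ps = \<Sigma> \<and> distinct qs \<and> set qs = Q \<and>
        x = Nd (enc_list enc_predicate ps) (enc_list enc_query qs))"

definition encodes_output :: "pointed set \<Rightarrow> tree \<Rightarrow> bool" where
  "encodes_output \<S> y \<longleftrightarrow>
     (\<exists>Ss. \<S> = (\<lambda>(fs, a). (set fs, a)) ` set Ss \<and> y = enc_list enc_pointed Ss)"

lemma enc_list_simps [simp]:
  "enc_list f [] = Lf" "enc_list f (x # xs) = Nd (f x) (enc_list f xs)"
  by (simp_all add: enc_list_def)

lemma inj_enc_list:
  assumes "inj f"
  shows "inj (enc_list f)"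
proof (rule injI)
  fix xs ys
  show "enc_list f xs = enc_list f ys \<Longrightarrow> xs = ys"
  proof (induction xs arbitrary: ys)
    case Nil
    then show ?case by (cases ys) auto
  next
    case (Cons x xs)
    then show ?case by (cases ys) (auto simp: inj_eq[OF assms])
  qed
qed

lemma inj_enc_name: "inj enc_name"
proof -
  have "inj enc_bool"
  proof (rule injI)
    fix b c show "enc_bool b = enc_bool c \<Longrightarrow> b = c" by (cases b; cases c) auto
  qed
  then show ?thesis unfolding enc_name_def by (rule inj_enc_list)
qed

lemma enc_name_eq_iff [simp]: "enc_name a = enc_name b \<longleftrightarrow> a = b"
  by (rule inj_eq[OF inj_enc_name])

lemma enc_tag_eq_iff [simp]: "enc_tag k = enc_tag l \<longleftrightarrow> k = l"
proof -
  have "tree_size (enc_tag k) = 2 * k + 1" for k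
    by (induction k) (auto simp: enc_tag_def)
  then have "2 * k + 1 = 2 * l + 1" if "enc_tag k = enc_tag l"
    using that by metis
  then show ?thesis by auto
qed

lemma inj_enc_predicate: "inj enc_predicate"
proof (rule injI)
  fix x y show "enc_predicate x = enc_predicate y \<Longrightarrow> x = y" by (cases x; cases y) auto
qed

lemma enc_role_eq_iff [simp]: "enc_role S = enc_role S' \<longleftrightarrow> S = S'"
  by (cases S; cases S') auto

lemma inj_enc_query: "inj enc_query"
proof (rule injI)
  fix q q' show "enc_query q = enc_query q' \<Longrightarrow> q = q'"
  proof (induction q arbitrary: q')
    case Top then show ?case by (cases q') auto
  next
    case (Atom A) then show ?case by (cases q') auto
  next
    case (And q1 q2) then show ?case by (cases q') auto
  next
    case (Ex S q) then show ?case by (cases q') auto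
  qed
qed

lemma inj_enc_fact: "inj enc_fact"
proof (rule injI)
  fix x y show "enc_fact x = enc_fact y \<Longrightarrow> x = y" by (cases x; cases y) auto
qed

lemma inj_enc_pointed: "inj enc_pointed"
proof (rule injI)
  fix x y show "enc_pointed x = enc_pointed y \<Longrightarrow> x = y"
    by (cases x; cases y) (simp add: enc_pointed_def inj_eq[OF inj_enc_list[OF inj_enc_fact]])
qed

lemma encodes_output_unique:
  assumes "encodes_output \<S> y" and "encodes_output \<S>' y"
  shows "\<S> = \<S>'"
proof -
  from assms obtain Ss Ss' where
    \<S>: "\<S> = (\<lambda>(fs, a). (set fs, a)) ` set Ss" "\<S>' = (\<lambda>(fs, a). (set fs, a)) ` set Ss'"
    and "enc_list enc_pointed Ss = enc_list enc_pointed Ss'"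
    unfolding encodes_output_def by metis
  from this(3) have "Ss = Ss'" by (rule injD[OF inj_enc_list[OF inj_enc_pointed]])
  with \<S> show ?thesis by simp
qed

lemma encodes_input_unique:
  assumes "encodes_input \<Sigma> Q x" and "encodes_input \<Sigma>' Q' x"
  shows "\<Sigma> = \<Sigma>' \<and> Q = Q'"
proof -
  from assms(1) obtain ps qs where 1: "set ps = \<Sigma>" "set qs = Q"
    "x = Nd (enc_list enc_predicate ps) (enc_list enc_query qs)"
    unfolding encodes_input_def by blast
  from assms(2) obtain ps' qs' where 2: "set ps' = \<Sigma>'" "set qs' = Q'"
    "x = Nd (enc_list enc_predicate ps') (enc_list enc_query qs')"
    unfolding encodes_input_def by blast
  from 1(3) 2(3) have *: "enc_list enc_predicate ps = enc_list enc_predicate ps'"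
    "enc_list enc_query qs = enc_list enc_query qs'" by simp_all
  have "ps = ps'" using *(1) by (rule injD[OF inj_enc_list[OF inj_enc_predicate]])
  moreover have "qs = qs'" using *(2) by (rule injD[OF inj_enc_list[OF inj_enc_query]])
  ultimately show ?thesis using 1 2 by simp
qed

text \<open>The program \<open>p\<close> computes, within time \<open>T\<close> of the input size, a split partner in \<open>L(\<Sigma>)\<close> of
  every finite set \<open>Q\<close> of \<open>L(\<Sigma>)\<close>-queries with property \<open>C\<close>, for all signatures \<open>\<Sigma>\<close>.\<close>

definition computes_split_partners ::
  "(signature \<Rightarrow> query set) \<Rightarrow> (query set \<Rightarrow> bool) \<Rightarrow> (nat \<Rightarrow> nat) \<Rightarrow> program \<Rightarrow> bool" where
  "computes_split_partners L C T p \<longleftrightarrow>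
     (\<forall>\<Sigma> Q x. is_signature \<Sigma> \<and> finite Q \<and> Q \<subseteq> L \<Sigma> \<and> C Q \<and> encodes_input \<Sigma> Q x \<longrightarrow>
        (\<exists>y t \<S>. runs p x y t \<and> t \<le> T (tree_size x) \<and>
           encodes_output \<S> y \<and> split_partner L \<Sigma> Q \<S>))"

end

theory Submission
  imports Defs
begin

text \<open>
  For (a) and (b), take as individuals lists \<open>L\<close> of queries that are declared false, with
  \<open>A(L)\<close> a fact iff \<open>A\<close> is not in \<open>L\<close>, and \<open>S(L, L')\<close> a fact iff for each \<open>\<exists>S.q\<close> in \<open>L\<close> some
  conjunct of \<open>q\<close> is in \<open>L'\<close>, and symmetrically for \<open>S\<^sup>-\<close>. By induction on queries, whatever \<open>L\<close>
  declares false is false at \<open>L\<close>. Pointing this instance at each \<open>L\<close> that contains a conjunct of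
  every \<open>q \<in> Q\<close> gives a split partner, provided that there are enough lists: all lists of
  subqueries of \<open>Q\<close> for \<open>ELI\<close>, and those of length at most \<open>n\<close> for \<open>EL\<close>, where falsity is only
  propagated forwards along edges. The instance is polynomial in the number of lists.

  For (c), there are \<open>2\<^sup>n\<close> queries, none of which entails \<open>q = \<exists>R.\<And>\<^sub>i(\<exists>R\<^sup>-.A\<^sub>i \<and> \<exists>R\<^sup>-.B\<^sub>i)\<close>, such that
  the conjunction of any two of them entails \<open>q\<close>. They must be satisfied in different members of a
  split partner of \<open>{q}\<close>.
\<close>

section \<open>Split partners from lists of false queries\<close>

fun elems :: "tree \<Rightarrow> tree list" where
  "elems Lf = []"
| "elems (Nd x xs) = x # elems xs"

lemma elems_enc_list [simp]: "elems (enc_list f xs) = map f xs"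
  by (induction xs) auto

abbreviation enc_trees :: "tree list \<Rightarrow> tree" where
  "enc_trees \<equiv> enc_list (\<lambda>t. t)"

lemma enc_trees_elems [simp]: "enc_trees (elems t) = t"
  by (induction t) auto

lemma elems_eq_Nil_iff [simp]: "elems t = [] \<longleftrightarrow> t = Lf"
  by (cases t) auto

lemma tree_size_left_le: "tree_size (left t) \<le> tree_size t"
  by (cases t) auto

lemma tree_size_right_le: "tree_size (right t) \<le> tree_size t"
  by (cases t) auto

text \<open>Preorder code of a tree, which turns lists of queries into individual names. Writing it
  in front of an accumulator lets the program build names without an append function.\<close>

fun ser :: "tree \<Rightarrow> name \<Rightarrow> name" where
  "ser Lf bs = False # bs"
| "ser (Nd s t) bs = True # ser s (ser t bs)"

text \<open>The preorder code is prefix-free: the first letter fixes the constructor, so the tree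
  and the rest of the word can be read off one after the other.\<close>

lemma ser_eq_iff: "ser s bs = ser t cs \<longleftrightarrow> s = t \<and> bs = cs"
proof (induction s arbitrary: t bs cs)
  case Lf
  then show ?case by (cases t) auto
next
  case (Nd s1 s2)
  then show ?case by (cases t) auto
qed

text \<open>A list \<open>L\<close> of queries stands for the assertion that all its members are false at an
  individual; \<open>refutes L q\<close> says that \<open>q\<close> is then false because one of its conjuncts is in \<open>L\<close>.
  Everything is phrased on encodings, as the program sees it.\<close>

function refutes :: "tree \<Rightarrow> tree \<Rightarrow> bool" where
  "refutes L Lf \<longleftrightarrow> False"
| "refutes L (Nd t r) \<longleftrightarrow> t \<noteq> Lf \<and>
     (if t = enc_tag 2 then refutes L (left r) \<or> refutes L (right r)
      else Nd t r \<in> set (elems L))"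
  by pat_completeness auto
termination
  \<comment> \<open>Since \<open>left Lf = Lf\<close> and \<open>right Lf = Lf\<close>, both parts
    of \<open>r\<close> are at most as large as \<open>r\<close>; strictness comes from the
    enclosing node.\<close>
  by (relation "measure (\<lambda>(L, q). tree_size q)")
    (auto simp: less_Suc_eq_le intro: trans_le_add2 tree_size_left_le tree_size_right_le)

lemma enc_tag_eq_Lf [simp]: "enc_tag k = Lf \<longleftrightarrow> k = 0"
  using enc_tag_eq_iff[of k 0] by (simp add: enc_tag_def)

lemma Lf_eq_enc_tag [simp]: "Lf = enc_tag k \<longleftrightarrow> k = 0"
  by (metis enc_tag_eq_Lf)

lemma enc_tag_0 [simp]: "enc_tag 0 = Lf"
  by simp

lemma refutes_enc_query [simp]:
  "refutes L (enc_query Top) \<longleftrightarrow> False"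
  "refutes L (enc_query (Atom A)) \<longleftrightarrow> enc_query (Atom A) \<in> set (elems L)"
  "refutes L (enc_query (And q1 q2)) \<longleftrightarrow> refutes L (enc_query q1) \<or> refutes L (enc_query q2)"
  "refutes L (enc_query (Ex S q)) \<longleftrightarrow> enc_query (Ex S q) \<in> set (elems L)"
  by simp_all

text \<open>Tag 3 marks existential queries. This is the condition on the two ends of an
  \<open>r\<close>-edge under which the edge does not make an existential query in \<open>L\<close>
  true.\<close>

definition compatible :: "tree \<Rightarrow> tree \<Rightarrow> tree \<Rightarrow> bool" where
  "compatible r L L' \<longleftrightarrow> (\<forall>c \<in> set (elems L).
     left c = enc_tag 3 \<and> left (right c) = r \<longrightarrow> refutes L' (right (right c)))"

fun inverse_role :: "role \<Rightarrow> role" where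
  "inverse_role (Fwd P) = Inv P"
| "inverse_role (Inv P) = Fwd P"

lemma role_holds_inverse_role [simp]:
  "role_holds \<A> (inverse_role S) a b \<longleftrightarrow> role_holds \<A> S b a"
  by (cases S) auto

text \<open>A query may traverse an edge in either direction, hence one condition for each.\<close>

definition edge :: "role \<Rightarrow> tree \<Rightarrow> tree \<Rightarrow> bool" where
  "edge S L L' \<longleftrightarrow> compatible (enc_role S) L L' \<and> compatible (enc_role (inverse_role S)) L' L"

lemma edge_inverse_role: "edge (inverse_role S) L L' \<longleftrightarrow> edge S L' L"
  by (cases S) (auto simp: edge_def)

section \<open>The instance whose individuals are lists of false queries\<close>

fun predicate_facts :: "tree list \<Rightarrow> predicate \<Rightarrow> fact list" where
  "predicate_facts Ls (Unary A) =
     [UFact A (ser L []). L \<leftarrow> Ls, enc_query (Atom A) \<notin> set (elems L)]"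
| "predicate_facts Ls (Binary P) =
     [BFact P (ser L []) (ser L' []). L \<leftarrow> Ls, L' \<leftarrow> Ls, edge (Fwd P) L L']"

definition partner_facts :: "tree list \<Rightarrow> predicate list \<Rightarrow> fact list" where
  "partner_facts Ls ps = concat (map (predicate_facts Ls) ps)"

definition partner :: "tree list \<Rightarrow> predicate list \<Rightarrow> query list \<Rightarrow> (fact list \<times> name) list" where
  "partner Ls ps qs =
     [(partner_facts Ls ps, ser L []). L \<leftarrow> Ls, \<forall>q \<in> set qs. refutes L (enc_query q)]"

lemma UFact_in_partner_facts:
  "UFact A a \<in> set (partner_facts Ls ps) \<longleftrightarrow> Unary A \<in> set ps \<and>
     (\<exists>L \<in> set Ls. a = ser L [] \<and> enc_query (Atom A) \<notin> set (elems L))"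
proof -
  have "UFact A a \<in> set (predicate_facts Ls p) \<longleftrightarrow> p = Unary A \<and>
     (\<exists>L \<in> set Ls. a = ser L [] \<and> enc_query (Atom A) \<notin> set (elems L))" for p
    by (cases p) (auto simp del: enc_query.simps)
  then show ?thesis by (auto simp: partner_facts_def)
qed

lemma BFact_in_partner_facts:
  "BFact P a b \<in> set (partner_facts Ls ps) \<longleftrightarrow> Binary P \<in> set ps \<and>
     (\<exists>L \<in> set Ls. \<exists>L' \<in> set Ls. a = ser L [] \<and> b = ser L' [] \<and> edge (Fwd P) L L')"
proof -
  have "BFact P a b \<in> set (predicate_facts Ls p) \<longleftrightarrow> p = Binary P \<and>
     (\<exists>L \<in> set Ls. \<exists>L' \<in> set Ls. a = ser L [] \<and> b = ser L' [] \<and> edge (Fwd P) L L')" for p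
    by (cases p) auto
  then show ?thesis by (auto simp: partner_facts_def)
qed

text \<open>Forward and inverse roles can be treated alike from here on, because
  \<open>inverse_role\<close> reverses \<open>edge\<close>.\<close>

lemma role_holds_partner_facts:
  "role_holds (set (partner_facts Ls ps)) S (ser L []) b \<longleftrightarrow>
     role_pred S \<in> set ps \<and> L \<in> set Ls \<and> (\<exists>L' \<in> set Ls. b = ser L' [] \<and> edge S L L')"
  using edge_inverse_role[of "Fwd _"]
  by (cases S) (auto simp: BFact_in_partner_facts ser_eq_iff)

lemma fact_pred_partner_facts: "fact_pred ` set (partner_facts Ls ps) \<subseteq> set ps"
proof
  fix p assume "p \<in> fact_pred ` set (partner_facts Ls ps)"
  then obtain \<phi> where "\<phi> \<in> set (partner_facts Ls ps)" "p = fact_pred \<phi>" by blast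
  then show "p \<in> set ps"
    by (cases \<phi> rule: fact.exhaust) (auto simp: UFact_in_partner_facts BFact_in_partner_facts)
qed

text \<open>Soundness, for an arbitrary list \<open>Ls\<close>. For \<open>Ex S q\<close>, the first
  half of \<open>edge\<close> passes a refutation of \<open>q\<close> to every
  \<open>S\<close>-successor, where the induction hypothesis applies.\<close>

lemma not_sat_partner_facts:
  "refutes L (enc_query q) \<Longrightarrow> \<not> sat (set (partner_facts Ls ps)) q (ser L [])"
proof (induction q arbitrary: L)
  case Top
  then show ?case by (simp del: enc_query.simps)
next
  case (Atom A)
  then show ?case by (auto simp: UFact_in_partner_facts ser_eq_iff simp del: enc_query.simps)
next
  case (And q1 q2)
  then show ?case by (auto simp del: enc_query.simps)
next
  case (Ex S q)
  then have "enc_query (Ex S q) \<in> set (elems L)" by (simp del: enc_query.simps)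
  then have "refutes L' (enc_query q)" if "edge S L L'" for L'
    using that by (force simp: edge_def compatible_def)
  then show ?case using Ex.IH by (auto simp: role_holds_partner_facts)
qed

section \<open>Enumeration of subqueries and of lists of them\<close>

text \<open>This spares the program from parsing queries: the subtrees of the encoding include the
  encodings of all subqueries. Others, such as tags and names, do no harm, as soundness holds for
  arbitrary lists.\<close>

fun subtrees :: "tree \<Rightarrow> tree list" where
  "subtrees Lf = []"
| "subtrees (Nd s t) = Nd s t # subtrees s @ subtrees t"

lemma in_subtrees_Nd:
  "Nd s t \<in> set (subtrees u) \<Longrightarrow> (s = Lf \<or> s \<in> set (subtrees u)) \<and> (t = Lf \<or> t \<in> set (subtrees u))"
proof (induction u)
  case (Nd u1 u2)
  have "v = Lf \<or> v \<in> set (subtrees v)" for v by (cases v) auto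
  with Nd show ?case by auto
qed simp

lemma enc_query_neq_Lf [simp]: "enc_query q \<noteq> Lf"
  by (cases q) auto

lemma subtrees_enc_query_And:
  assumes "enc_query (And q1 q2) \<in> set (subtrees u)"
  shows "enc_query q1 \<in> set (subtrees u)" "enc_query q2 \<in> set (subtrees u)"
proof -
  have "Nd (enc_query q1) (enc_query q2) \<in> set (subtrees u)"
    using assms by (auto dest!: in_subtrees_Nd)
  then show "enc_query q1 \<in> set (subtrees u)" "enc_query q2 \<in> set (subtrees u)"
    by (auto dest!: in_subtrees_Nd)
qed

lemma subtrees_enc_query_Ex:
  assumes "enc_query (Ex S q) \<in> set (subtrees u)"
  shows "enc_query q \<in> set (subtrees u)"
proof -
  have "Nd (enc_role S) (enc_query q) \<in> set (subtrees u)"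
    using assms by (auto dest!: in_subtrees_Nd)
  then show ?thesis by (auto dest!: in_subtrees_Nd)
qed

lemma subtrees_enc_list: "q \<in> set qs \<Longrightarrow> enc_query q \<in> set (subtrees (enc_list enc_query qs))"
proof (induction qs)
  case (Cons q' qs)
  have "v = Lf \<or> v \<in> set (subtrees v)" for v by (cases v) auto
  from this[of "enc_query q'"] Cons show ?case by auto
qed simp

fun tuples :: "nat \<Rightarrow> tree list \<Rightarrow> tree list" where
  "tuples 0 xs = [Lf]"
| "tuples (Suc k) xs = Lf # concat (map (\<lambda>x. map (Nd x) (tuples k xs)) xs)"

lemma set_tuples: "set (tuples k xs) = {L. length (elems L) \<le> k \<and> set (elems L) \<subseteq> set xs}"
proof (induction k)
  case 0
  show ?case by auto
next
  case (Suc k)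
  have "L \<in> set (tuples (Suc k) xs) \<longleftrightarrow> length (elems L) \<le> Suc k \<and> set (elems L) \<subseteq> set xs" for L
  proof (cases L)
    case Lf
    then show ?thesis by simp
  next
    case (Nd x L')
    then have "L \<in> set (tuples (Suc k) xs) \<longleftrightarrow> x \<in> set xs \<and> L' \<in> set (tuples k xs)" by auto
    with Nd show ?thesis unfolding Suc.IH by auto
  qed
  then show ?case by blast
qed

section \<open>Split partners in the two query languages\<close>

text \<open>The constructed instance is itself the countermodel to entailment, for every
  \<open>Ls\<close> and every language. So only completeness is left as an assumption, to be shown
  for each language separately.\<close>

lemma split_partner_partner:
  assumes complete: "\<And>q'. q' \<in> \<L> (set ps) \<Longrightarrow> (\<And>q. q \<in> set qs \<Longrightarrow> \<not> entails q' q) \<Longrightarrow>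
    \<exists>L \<in> set Ls. (\<forall>q \<in> set qs. refutes L (enc_query q)) \<and>
      sat (set (partner_facts Ls ps)) q' (ser L [])"
  shows "split_partner \<L> (set ps) (set qs) ((\<lambda>(fs, a). (set fs, a)) ` set (partner Ls ps qs))"
    (is "split_partner _ _ _ ?S")
proof -
  let ?F = "set (partner_facts Ls ps)"
  have S: "?S = {(?F, ser L []) | L. L \<in> set Ls \<and> (\<forall>q \<in> set qs. refutes L (enc_query q))}"
    by (auto simp: partner_def image_iff)
  have over: "data_instance_over (set ps) ?F"
    using fact_pred_partner_facts by (simp add: data_instance_over_def data_instance_def)
  have sound: "\<not> entails q' q"
    if "sat ?F q' (ser L [])" "refutes L (enc_query q)" for q' q L
    using that not_sat_partner_facts[of L q] by (auto simp: entails_def data_instance_def)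
  have iff: "(\<exists>(\<A>, a) \<in> ?S. sat \<A> q' a) \<longleftrightarrow> (\<forall>q \<in> set qs. \<not> entails q' q)" if "q' \<in> \<L> (set ps)" for q'
  proof
    assume "\<exists>(\<A>, a) \<in> ?S. sat \<A> q' a"
    then show "\<forall>q \<in> set qs. \<not> entails q' q" using sound unfolding S by blast
  next
    assume "\<forall>q \<in> set qs. \<not> entails q' q"
    then show "\<exists>(\<A>, a) \<in> ?S. sat \<A> q' a" using complete[OF that] unfolding S by blast
  qed
  have "finite ?S" by simp
  moreover have "\<forall>(\<A>, a) \<in> ?S. data_instance_over (set ps) \<A>" unfolding S using over by auto
  ultimately show ?thesis unfolding split_partner_def 
    by (intro conjI) (assumption | rule iff | rule ballI)+
qed

text \<open>Witness individuals are tuples of individuals in countermodels \<open>M i\<close>, one for each \<open>i \<in> Q\<close>: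
  in the product of the countermodels, a query is true iff it is true in every component. Such a
  tuple is represented by the list of all subqueries that are false at it.\<close>

lemma ELI_partner_complete:
  assumes "q' \<in> ELI (set ps)" and "\<And>q. q \<in> set qs \<Longrightarrow> \<not> entails q' q"
  defines "xs \<equiv> subtrees (enc_list enc_query qs)"
  defines "Ls \<equiv> tuples (length xs) xs"
  shows "\<exists>L \<in> set Ls. (\<forall>q \<in> set qs. refutes L (enc_query q)) \<and>
    sat (set (partner_facts Ls ps)) q' (ser L [])"
proof -
  \<comment> \<open>The implication makes the choice functions \<open>M\<close> and \<open>a\<close>
    total, with arbitrary values outside \<open>set qs\<close>.\<close>
  have "\<forall>i. \<exists>\<A> a. i \<in> set qs \<longrightarrow> sat \<A> q' a \<and> \<not> sat \<A> i a"
    using assms(2) unfolding entails_def by blast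
  then obtain M a where M: "\<And>i. i \<in> set qs \<Longrightarrow> sat (M i) q' (a i) \<and> \<not> sat (M i) i (a i)"
    by metis
  define holds where "holds q b \<longleftrightarrow> (\<forall>i \<in> set qs. sat (M i) q (b i))" for q b
  define L where
    "L b = enc_trees (filter (\<lambda>c. \<exists>q. c = enc_query q \<and> \<not> holds q b) xs)" for b
  have elems_L: "enc_query q \<in> set (elems (L b)) \<longleftrightarrow> enc_query q \<in> set xs \<and> \<not> holds q b" for q b
    by (auto simp: L_def dest: injD[OF inj_enc_query])
  \<comment> \<open>A sublist selected by \<open>filter\<close> is no longer than \<open>xs\<close>,
    and \<open>length xs\<close> is the bound built into \<open>Ls\<close>.\<close>
  have L_Ls: "L b \<in> set Ls" for b
    by (auto simp: Ls_def set_tuples L_def)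
  have refutes_L: "refutes (L b) (enc_query q)" if "enc_query q \<in> set xs" "\<not> holds q b" for q b
    using that
  proof (induction q)
    case Top
    then show ?case by (simp add: holds_def)
  next
    case (And q1 q2)
    then have "\<not> holds q1 b \<or> \<not> holds q2 b" by (auto simp: holds_def)
    with And show ?case
      using subtrees_enc_query_And[of q1 q2 "enc_list enc_query qs"]
      by (auto simp: xs_def simp del: enc_query.simps)
  qed (simp_all add: elems_L del: enc_query.simps)
  \<comment> \<open>Stated for every role: the second half of \<open>edge\<close> is the instance
    for \<open>inverse_role S\<close> with \<open>b\<close> and \<open>b'\<close> exchanged.\<close>
  have compatible: "compatible (enc_role S) (L b) (L b')"
    if *: "\<And>i. i \<in> set qs \<Longrightarrow> role_holds (M i) S (b i) (b' i)" for S b b'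
    unfolding compatible_def
  proof (intro ballI impI)
    fix c assume c: "c \<in> set (elems (L b))" "left c = enc_tag 3 \<and> left (right c) = enc_role S"
    then obtain q where q: "c = enc_query q" by (auto simp: L_def)
    from c(2) q obtain d where d: "q = Ex S d" by (cases q) auto
    have "enc_query d \<in> set xs" "\<not> holds d b'"
      using c(1) * subtrees_enc_query_Ex[of S d] unfolding q d elems_L
      by (auto simp: holds_def xs_def simp del: enc_query.simps)
    then show "refutes (L b') (right (right c))" using refutes_L q d by simp
  qed
  have "preds q \<subseteq> set ps \<Longrightarrow> holds q b \<Longrightarrow> sat (set (partner_facts Ls ps)) q (ser (L b) [])" for q b
  proof (induction q arbitrary: b)
    case (Atom A)
    then have "enc_query (Atom A) \<notin> set (elems (L b))" unfolding elems_L by simp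
    with Atom L_Ls show ?case by (auto simp: UFact_in_partner_facts simp del: enc_query.simps)
  next
    case (Ex S q)
    \<comment> \<open>A successor is chosen in each countermodel; the tuple \<open>b'\<close> of
      these is a successor in the product.\<close>
    then have "\<forall>i. \<exists>c. i \<in> set qs \<longrightarrow> role_holds (M i) S (b i) c \<and> sat (M i) q c"
      by (auto simp: holds_def)
    then obtain b' where b': "\<And>i. i \<in> set qs \<Longrightarrow> role_holds (M i) S (b i) (b' i) \<and> sat (M i) q (b' i)"
      by metis
    then have "edge S (L b) (L b')" by (auto simp: edge_def intro!: compatible)
    moreover have "sat (set (partner_facts Ls ps)) q (ser (L b') [])"
      using Ex b' by (auto simp: holds_def)
    ultimately show ?case using Ex.prems L_Ls by (auto simp: role_holds_partner_facts)
  qed (auto simp: holds_def)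
  moreover have "holds q' a" "preds q' \<subseteq> set ps" using M assms(1) by (auto simp: holds_def ELI_def)
  moreover have "\<forall>q \<in> set qs. refutes (L a) (enc_query q)"
  proof
    fix q assume "q \<in> set qs"
    with M have "\<not> holds q a" unfolding holds_def by blast
    with \<open>q \<in> set qs\<close> show "refutes (L a) (enc_query q)"
      by (intro refutes_L) (simp_all add: xs_def subtrees_enc_list)
  qed
  ultimately show ?thesis using L_Ls by blast
qed

text \<open>A query that does not entail a conjunction fails to entail one of the two conjuncts. The
  descent ends at an atom or an existential query, as \<open>Top\<close> is always entailed, and
  this single query in \<open>L\<close> suffices to refute \<open>d\<close>.\<close>

lemma not_entails_conjunct:
  assumes "\<not> entails q' d" and "enc_query d \<in> set (subtrees u)" and "inverse_free d"
  shows "\<exists>c. \<not> entails q' c \<and> enc_query c \<in> set (subtrees u) \<and> inverse_free c \<and>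
    (\<forall>L. enc_query c \<in> set (elems L) \<longrightarrow> refutes L (enc_query d))"
  using assms
proof (induction d)
  case Top
  then show ?case by (auto simp: entails_def)
next
  case (Atom A)
  then show ?case by (metis refutes_enc_query(2))
next
  case (And d1 d2)
  then have "\<not> entails q' d1 \<or> \<not> entails q' d2" by (auto simp: entails_def)
  with And show ?case
    using subtrees_enc_query_And[of d1 d2 u] by (metis inverse_free.simps(3) refutes_enc_query(3))
next
  case (Ex S d)
  then show ?case by (metis refutes_enc_query(4))
qed

text \<open>Without inverse roles, an edge only transfers the falsity of \<open>\<exists>P.d\<close> at its source to the
  falsity of one conjunct of \<open>d\<close> at its target, so the number of queries that have to be
  declared false does not grow along edges.\<close>

lemma EL_partner_complete:
  assumes "q' \<in> EL (set ps)" and "\<And>q. q \<in> set qs \<Longrightarrow> \<not> entails q' q"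
    and "length qs \<le> n" and "\<And>q. q \<in> set qs \<Longrightarrow> inverse_free q"
  defines "xs \<equiv> subtrees (enc_list enc_query qs)"
  defines "Ls \<equiv> tuples n xs"
  shows "\<exists>L \<in> set Ls. (\<forall>q \<in> set qs. refutes L (enc_query q)) \<and>
    sat (set (partner_facts Ls ps)) q' (ser L [])"
proof -
  let ?ok = "\<lambda>q' ds. length ds \<le> n \<and>
    (\<forall>d \<in> set ds. \<not> entails q' d \<and> enc_query d \<in> set xs \<and> inverse_free d)"
  let ?L = "enc_list enc_query"
  \<comment> \<open>One conjunct is chosen for each member of \<open>ds\<close>, so the length bound
    \<open>n\<close> is preserved.\<close>
  have step: "\<exists>cs. ?ok q' cs \<and> (\<forall>d \<in> set ds. refutes (?L cs) (enc_query d))"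
    if "?ok q' ds" for q' ds
  proof -
    have "\<forall>d. \<exists>c. d \<in> set ds \<longrightarrow> \<not> entails q' c \<and> enc_query c \<in> set xs \<and> inverse_free c \<and>
      (\<forall>L. enc_query c \<in> set (elems L) \<longrightarrow> refutes L (enc_query d))"
      using that not_entails_conjunct[of q' _ "?L qs"] unfolding xs_def by blast
    then obtain f where "\<And>d. d \<in> set ds \<Longrightarrow> \<not> entails q' (f d) \<and> enc_query (f d) \<in> set xs \<and>
      inverse_free (f d) \<and> (\<forall>L. enc_query (f d) \<in> set (elems L) \<longrightarrow> refutes L (enc_query d))"
      by metis
    then show ?thesis using that by (intro exI[of _ "map f ds"]) auto
  qed
  have L_Ls: "?L ds \<in> set Ls" if "?ok q' ds" for q' ds
    using that by (auto simp: Ls_def set_tuples)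
  \<comment> \<open>The invariant of the induction: the current subquery entails no member of the
    current list \<open>ds\<close>.\<close>
  have "preds q' \<subseteq> set ps \<Longrightarrow> inverse_free q' \<Longrightarrow> ?ok q' ds \<Longrightarrow>
    sat (set (partner_facts Ls ps)) q' (ser (?L ds) [])" for q' ds
  proof (induction q' arbitrary: ds)
    case (Atom A)
    then have "Atom A \<notin> set ds" by (auto simp: entails_def)
    then have "enc_query (Atom A) \<notin> set (elems (?L ds))"
      by (auto dest: injD[OF inj_enc_query] simp del: enc_query.simps)
    with Atom L_Ls[OF Atom.prems(3)] show ?case
      by (auto simp: UFact_in_partner_facts simp del: enc_query.simps)
  next
    case (And q1 q2)
    have "\<not> entails q1 d" "\<not> entails q2 d" if "\<not> entails (And q1 q2) d" for d
      using that unfolding entails_def by auto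
    with And.prems have "?ok q1 ds" "?ok q2 ds" by blast+
    with And show ?case by simp
  next
    case (Ex S q)
    then obtain P where P: "S = Fwd P" by auto
    \<comment> \<open>The bodies of the existential queries over \<open>S\<close> in
      \<open>ds\<close>, which have to be refuted at the successor.\<close>
    define ds' where "ds' = [d. Ex R d \<leftarrow> ds, R = S]"
    have in_ds': "d \<in> set ds' \<longleftrightarrow> Ex S d \<in> set ds" for d
      by (force simp: ds'_def split: query.splits)
    have "length ds' \<le> length ds"
      unfolding ds'_def by (induction ds) (auto split: query.splits)
    \<comment> \<open>Monotonicity of entailment under \<open>Ex S\<close>, in contrapositive
      form.\<close>
    moreover have "\<not> entails q d" if "\<not> entails (Ex S q) (Ex S d)" for d
      using that by (auto simp: entails_def)
    ultimately have "?ok q ds'"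
      using Ex.prems(3) subtrees_enc_query_Ex[of S _ "?L qs"]
      by (force simp: in_ds' xs_def simp del: enc_query.simps)
    then obtain cs where cs: "?ok q cs" "\<forall>d \<in> set ds'. refutes (?L cs) (enc_query d)"
      using step by blast
    have "compatible (enc_role S) (?L ds) (?L cs)"
      unfolding compatible_def
    proof (intro ballI impI)
      fix c assume c: "c \<in> set (elems (?L ds))" "left c = enc_tag 3 \<and> left (right c) = enc_role S"
      then obtain e where e: "c = enc_query e" "e \<in> set ds" by auto
      from c(2) e(1) obtain d where "e = Ex S d" by (cases e) auto
      with e cs show "refutes (?L cs) (right (right c))" by (auto simp: in_ds')
    qed
    \<comment> \<open>Vacuously true: the members of \<open>cs\<close> are inverse-free, whereas the
      inverse of \<open>S = Fwd P\<close> is an inverse role.\<close>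
    moreover have "compatible (enc_role (inverse_role S)) (?L cs) (?L ds)"
      unfolding compatible_def
    proof (intro ballI impI)
      fix c assume c: "c \<in> set (elems (?L cs))"
        "left c = enc_tag 3 \<and> left (right c) = enc_role (inverse_role S)"
      then obtain e where e: "c = enc_query e" "e \<in> set cs" by auto
      from c(2) e(1) obtain d where "e = Ex (inverse_role S) d" by (cases e) auto
      with e cs P show "refutes (?L ds) (right (right c))" by auto
    qed
    ultimately have "edge S (?L ds) (?L cs)" by (simp add: edge_def)
    moreover have "sat (set (partner_facts Ls ps)) q (ser (?L cs) [])"
      using Ex.IH Ex.prems cs by auto
    ultimately show ?case
      using Ex.prems L_Ls[OF Ex.prems(3)] L_Ls[OF cs(1)] by (auto simp: role_holds_partner_facts)
  qed simp
  moreover have "?ok q' qs" using assms(2-4) by (auto simp: xs_def subtrees_enc_list)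
  then obtain cs where cs: "?ok q' cs" "\<forall>d \<in> set qs. refutes (?L cs) (enc_query d)"
    using step by blast
  ultimately have "sat (set (partner_facts Ls ps)) q' (ser (?L cs) [])"
    using assms(1) by (auto simp: EL_def ELI_def)
  then show ?thesis using cs L_Ls by blast
qed

section \<open>A program computing split partners\<close>

text \<open>Determinism of \<open>eval\<close> makes value and cost of a halting call unique, so
  both can be functions that stay opaque while a body is executed.\<close>

definition call_val :: "program \<Rightarrow> nat \<Rightarrow> tree list \<Rightarrow> tree" where
  "call_val p f vs = (THE v. \<exists>t. eval p vs (p ! f) v t)"

definition call_cost :: "program \<Rightarrow> nat \<Rightarrow> tree list \<Rightarrow> nat" where
  "call_cost p f vs = (THE t. \<exists>v. eval p vs (p ! f) v t)"

definition call_halts :: "program \<Rightarrow> nat \<Rightarrow> tree list \<Rightarrow> bool" where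
  "call_halts p f vs \<longleftrightarrow> f < length p \<and> (\<exists>v t. eval p vs (p ! f) v t)"

text \<open>These functions evaluate an expression symbolically, up to its function calls, so that the
  simplifier can execute the body of a function.\<close>

fun expr_val :: "program \<Rightarrow> tree list \<Rightarrow> expr \<Rightarrow> tree" where
  "expr_val p env (Var i) = env ! i"
| "expr_val p env LfE = Lf"
| "expr_val p env (NdE e1 e2) = Nd (expr_val p env e1) (expr_val p env e2)"
| "expr_val p env (LeftE e) = left (expr_val p env e)"
| "expr_val p env (RightE e) = right (expr_val p env e)"
| "expr_val p env (EqE e1 e2) = enc_bool (expr_val p env e1 = expr_val p env e2)"
| "expr_val p env (IfE e0 e1 e2) =
     (if expr_val p env e0 \<noteq> Lf then expr_val p env e1 else expr_val p env e2)"
| "expr_val p env (Call f es) = call_val p f (map (expr_val p env) es)"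

fun expr_cost :: "program \<Rightarrow> tree list \<Rightarrow> expr \<Rightarrow> nat" where
  "expr_cost p env (Var i) = 1 + tree_size (env ! i)"
| "expr_cost p env LfE = 1"
| "expr_cost p env (NdE e1 e2) = 1 + expr_cost p env e1 + expr_cost p env e2"
| "expr_cost p env (LeftE e) = 1 + expr_cost p env e"
| "expr_cost p env (RightE e) = 1 + expr_cost p env e"
| "expr_cost p env (EqE e1 e2) = 2 + expr_cost p env e1 + expr_cost p env e2"
| "expr_cost p env (IfE e0 e1 e2) = 1 + expr_cost p env e0 +
     (if expr_val p env e0 \<noteq> Lf then expr_cost p env e1 else expr_cost p env e2)"
| "expr_cost p env (Call f es) =
     1 + sum_list (map (expr_cost p env) es) + call_cost p f (map (expr_val p env) es)"

fun expr_halts :: "program \<Rightarrow> tree list \<Rightarrow> expr \<Rightarrow> bool" where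
  "expr_halts p env (Var i) \<longleftrightarrow> i < length env"
| "expr_halts p env LfE \<longleftrightarrow> True"
| "expr_halts p env (NdE e1 e2) \<longleftrightarrow> expr_halts p env e1 \<and> expr_halts p env e2"
| "expr_halts p env (LeftE e) \<longleftrightarrow> expr_halts p env e"
| "expr_halts p env (RightE e) \<longleftrightarrow> expr_halts p env e"
| "expr_halts p env (EqE e1 e2) \<longleftrightarrow> expr_halts p env e1 \<and> expr_halts p env e2"
| "expr_halts p env (IfE e0 e1 e2) \<longleftrightarrow> expr_halts p env e0 \<and>
     (if expr_val p env e0 \<noteq> Lf then expr_halts p env e1 else expr_halts p env e2)"
| "expr_halts p env (Call f es) \<longleftrightarrow>
     (\<forall>e \<in> set es. expr_halts p env e) \<and> call_halts p f (map (expr_val p env) es)"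

lemma call_eqI:
  assumes "eval p vs (p ! f) v t"
  shows "call_val p f vs = v" "call_cost p f vs = t"
  using assms eval_deterministic unfolding call_val_def call_cost_def by blast+

lemma eval_expr: "expr_halts p env e \<Longrightarrow> eval p env e (expr_val p env e) (expr_cost p env e)"
proof (induction e)
  case (EqE e1 e2)
  then show ?case using eval_Eq by fastforce
next
  case (IfE e0 e1 e2)
  then show ?case using eval_If_then eval_If_else by fastforce
next
  case (Call f es)
  let ?vs = "map (expr_val p env) es"
  from Call.prems obtain v t where f: "f < length p" "eval p ?vs (p ! f) v t"
    by (auto simp: call_halts_def)
  have "eval p env (Call f es) v (1 + sum_list (map (expr_cost p env) es) + t)"
    using f Call by (intro eval_Call[where vs = ?vs]) auto
  then show ?case using call_eqI[OF f(2)] by simp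
qed (use eval_Var eval_Lf eval_Nd eval_Left eval_Right in fastforce)+

definition computes_call :: "program \<Rightarrow> nat \<Rightarrow> tree list \<Rightarrow> tree \<Rightarrow> nat \<Rightarrow> bool" where
  "computes_call p f vs v B \<longleftrightarrow> f < length p \<and> (\<exists>t\<le>B. eval p vs (p ! f) v t)"

text \<open>With this rule the simplifier verifies a function by executing its body;
  \<open>computes_callD\<close> provides the values and cost bounds of the calls made there,
  including recursive ones.\<close>

lemma computes_callI:
  assumes "f < length p" "expr_halts p vs (p ! f)" "expr_val p vs (p ! f) = v"
    "expr_cost p vs (p ! f) \<le> B"
  shows "computes_call p f vs v B"
  using assms eval_expr unfolding computes_call_def by blast

lemma computes_callD:
  assumes "computes_call p f vs v B"
  shows "call_halts p f vs \<and> call_val p f vs = v \<and> call_cost p f vs \<le> B"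
  using assms call_eqI unfolding computes_call_def call_halts_def by blast

lemma computes_call_mono: "computes_call p f vs v B \<Longrightarrow> B \<le> B' \<Longrightarrow> computes_call p f vs v B'"
  unfolding computes_call_def using le_trans by blast

lemma enc_bool_eq_Lf [simp]: "enc_bool b = Lf \<longleftrightarrow> \<not> b"
  by (cases b) auto

lemma tree_size_enc_tag [simp]: "tree_size (enc_tag k) = 2 * k + 1"
  by (induction k) (auto simp: enc_tag_def)

lemma tree_size_enc_list: "tree_size (enc_list f xs) = 1 + (\<Sum>x\<leftarrow>xs. 1 + tree_size (f x))"
  by (induction xs) auto

lemma tree_size_pos: "tree_size t > 0"
  by (cases t) auto

lemma enc_name_simps [simp]: "enc_name [] = Lf" "enc_name (b # bs) = Nd (enc_bool b) (enc_name bs)"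
  by (simp_all add: enc_name_def)

text \<open>A node contributes a letter \<open>True\<close>, which adds 4 to the encoded name, and a
  leaf a letter \<open>False\<close>, which adds 2.\<close>

lemma tree_size_ser_le: "tree_size (enc_name (ser t bs)) \<le> 4 * tree_size t + tree_size (enc_name bs)"
proof (induction t arbitrary: bs)
  case (Nd s t)
  show ?case using Nd.IH(1)[of "ser t bs"] Nd.IH(2)[of bs] by simp
qed simp

abbreviation TrueE :: expr where
  "TrueE \<equiv> NdE LfE LfE"

definition TagE :: "nat \<Rightarrow> expr" where
  "TagE k = (NdE LfE ^^ k) LfE"

lemma TagE_simps [simp]:
  "expr_halts p env (TagE k)" "expr_val p env (TagE k) = enc_tag k" "expr_cost p env (TagE k) = 2 * k + 1"
  by (induction k) (auto simp: TagE_def enc_tag_def)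

section \<open>The functions of the program\<close>

abbreviation (input) main_fn :: nat where "main_fn \<equiv> 0"
abbreviation (input) nodes_fn :: nat where "nodes_fn \<equiv> 1"
abbreviation (input) result_fn :: nat where "result_fn \<equiv> 2"
abbreviation (input) pointed_fn :: nat where "pointed_fn \<equiv> 3"
abbreviation (input) refutes_all_fn :: nat where "refutes_all_fn \<equiv> 4"
abbreviation (input) facts_fn :: nat where "facts_fn \<equiv> 5"
abbreviation (input) unary_fn :: nat where "unary_fn \<equiv> 6"
abbreviation (input) binary_fn :: nat where "binary_fn \<equiv> 7"
abbreviation (input) edges_fn :: nat where "edges_fn \<equiv> 8"
abbreviation (input) compatible_fn :: nat where "compatible_fn \<equiv> 9"
abbreviation (input) refutes_fn :: nat where "refutes_fn \<equiv> 10"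
abbreviation (input) member_fn :: nat where "member_fn \<equiv> 11"
abbreviation (input) ser_fn :: nat where "ser_fn \<equiv> 12"
abbreviation (input) tuples_fn :: nat where "tuples_fn \<equiv> 13"
abbreviation (input) extend_all_fn :: nat where "extend_all_fn \<equiv> 14"
abbreviation (input) extend_fn :: nat where "extend_fn \<equiv> 15"
abbreviation (input) subtrees_fn :: nat where "subtrees_fn \<equiv> 16"

definition main_body :: expr where
  "main_body = Call nodes_fn
     [LeftE (Var 0), RightE (Var 0), Call subtrees_fn [RightE (Var 0), LfE]]"

text \<open>\<open>K\<close> is evaluated where \<open>Var 0\<close>, \<open>Var 1\<close> and
  \<open>Var 2\<close> are the predicates, the queries and the collected subtrees; it can be a
  constant or depend on the input.\<close>

definition nodes_body :: "expr \<Rightarrow> expr" where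
  "nodes_body K = Call result_fn [Var 0, Var 1, Call tuples_fn [K, Var 2]]"

definition result_body :: expr where
  "result_body = Call pointed_fn [Var 2, Var 1, Call facts_fn [Var 0, Var 2]]"

text \<open>The \<open>let\<close> is expanded when the program is formed. The copies of
  \<open>rest\<close> lie in different branches, so at most one of them is evaluated.\<close>

definition pointed_body :: expr where
  "pointed_body = (let rest = Call pointed_fn [RightE (Var 0), Var 1, Var 2] in
     IfE (Var 0)
       (IfE (Call refutes_all_fn [Var 1, LeftE (Var 0)])
         (NdE (NdE (Var 2) (Call ser_fn [LeftE (Var 0), LfE])) rest)
         rest)
       LfE)"

definition refutes_all_body :: expr where
  "refutes_all_body = IfE (Var 0)
     (IfE (Call refutes_fn [Var 1, LeftE (Var 0)]) (Call refutes_all_fn [RightE (Var 0), Var 1]) LfE)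
     TrueE"

text \<open>The inner test reads the tag of the first predicate, which is \<open>Lf\<close> exactly
  for unary symbols.\<close>

definition facts_body :: expr where
  "facts_body = (let rest = Call facts_fn [RightE (Var 0), Var 1]; P = RightE (LeftE (Var 0)) in
     IfE (Var 0)
       (IfE (LeftE (LeftE (Var 0)))
         (Call binary_fn [Var 1, P, Var 1, rest])
         (Call unary_fn [Var 1, P, rest]))
       LfE)"

text \<open>The last argument is the list in front of which the new facts are put. This again avoids
  an append function, as in \<open>binary_body\<close>, \<open>edges_body\<close>,
  \<open>extend_body\<close> and \<open>subtrees_body\<close>.\<close>

definition unary_body :: expr where
  "unary_body = (let rest = Call unary_fn [RightE (Var 0), Var 1, Var 2] in
     IfE (Var 0)
       (IfE (Call member_fn [LeftE (Var 0), NdE (TagE 1) (Var 1)])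
         rest
         (NdE (NdE LfE (NdE (Var 1) (Call ser_fn [LeftE (Var 0), LfE]))) rest))
       (Var 2))"

definition binary_body :: expr where
  "binary_body = IfE (Var 0)
     (Call edges_fn [Var 2, Var 1, LeftE (Var 0), Call binary_fn [RightE (Var 0), Var 1, Var 2, Var 3]])
     (Var 3)"

definition edges_body :: expr where
  "edges_body = (let rest = Call edges_fn [RightE (Var 0), Var 1, Var 2, Var 3] in
     IfE (Var 0)
       (IfE (IfE (Call compatible_fn [Var 2, NdE LfE (Var 1), LeftE (Var 0)])
              (Call compatible_fn [LeftE (Var 0), NdE (TagE 1) (Var 1), Var 2])
              LfE)
         (NdE (NdE (TagE 1)
                (NdE (Var 1) (NdE (Call ser_fn [Var 2, LfE]) (Call ser_fn [LeftE (Var 0), LfE]))))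
           rest)
         rest)
       (Var 3))"

definition compatible_body :: expr where
  "compatible_body = (let c = LeftE (Var 0); rest = Call compatible_fn [RightE (Var 0), Var 1, Var 2] in
     IfE (Var 0)
       (IfE (EqE (LeftE c) (TagE 3))
         (IfE (EqE (LeftE (RightE c)) (Var 1))
           (IfE (Call refutes_fn [Var 2, RightE (RightE c)]) rest LfE)
           rest)
         rest)
       TrueE)"

text \<open>By \<open>left Lf = Lf\<close>, the first test covers both the argument
  \<open>Lf\<close> and tag 0, which is the tag of \<open>Top\<close>.\<close>

definition refutes_body :: expr where
  "refutes_body = IfE (LeftE (Var 1))
     (IfE (EqE (LeftE (Var 1)) (TagE 2))
       (IfE (Call refutes_fn [Var 0, LeftE (RightE (Var 1))])
         TrueE
         (Call refutes_fn [Var 0, RightE (RightE (Var 1))]))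
       (Call member_fn [Var 0, Var 1]))
     LfE"

definition member_body :: expr where
  "member_body = IfE (Var 0)
     (IfE (EqE (LeftE (Var 0)) (Var 1)) TrueE (Call member_fn [RightE (Var 0), Var 1]))
     LfE"

definition ser_body :: expr where
  "ser_body = IfE (Var 0)
     (NdE TrueE (Call ser_fn [LeftE (Var 0), Call ser_fn [RightE (Var 0), Var 1]]))
     (NdE LfE (Var 1))"

definition tuples_body :: expr where
  "tuples_body = IfE (Var 0)
     (NdE LfE (Call extend_all_fn [Var 1, Call tuples_fn [RightE (Var 0), Var 1]]))
     (NdE LfE LfE)"

definition extend_all_body :: expr where
  "extend_all_body = IfE (Var 0)
     (Call extend_fn [Var 1, LeftE (Var 0), Call extend_all_fn [RightE (Var 0), Var 1]])
     LfE"

definition extend_body :: expr where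
  "extend_body = IfE (Var 0)
     (NdE (NdE (Var 1) (LeftE (Var 0))) (Call extend_fn [RightE (Var 0), Var 1, Var 2]))
     (Var 2)"

definition subtrees_body :: expr where
  "subtrees_body = IfE (Var 0)
     (NdE (Var 0) (Call subtrees_fn [LeftE (Var 0), Call subtrees_fn [RightE (Var 0), Var 1]]))
     (Var 1)"

text \<open>The expression \<open>K\<close> computes a list whose length bounds the length of the lists \<open>L\<close>.\<close>

definition partner_program :: "expr \<Rightarrow> program" where
  "partner_program K =
    [main_body, nodes_body K, result_body, pointed_body, refutes_all_body, facts_body, unary_body,
     binary_body, edges_body, compatible_body, refutes_body, member_body, ser_body, tuples_body,
     extend_all_body, extend_body, subtrees_body]"

lemma partner_program_simps [simp]:
  "length (partner_program K) = 17"
  "partner_program K ! main_fn = main_body"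
  "partner_program K ! nodes_fn = nodes_body K"
  "partner_program K ! Suc 0 = nodes_body K"
  "partner_program K ! result_fn = result_body"
  "partner_program K ! pointed_fn = pointed_body"
  "partner_program K ! refutes_all_fn = refutes_all_body"
  "partner_program K ! facts_fn = facts_body"
  "partner_program K ! unary_fn = unary_body"
  "partner_program K ! binary_fn = binary_body"
  "partner_program K ! edges_fn = edges_body"
  "partner_program K ! compatible_fn = compatible_body"
  "partner_program K ! refutes_fn = refutes_body"
  "partner_program K ! member_fn = member_body"
  "partner_program K ! ser_fn = ser_body"
  "partner_program K ! tuples_fn = tuples_body"
  "partner_program K ! extend_all_fn = extend_all_body"
  "partner_program K ! extend_fn = extend_body"
  "partner_program K ! subtrees_fn = subtrees_body"
  by (simp_all add: partner_program_def)

text \<open>In the following bounds, \<open>M\<close> bounds the sizes of all values that occur, and \<open>step_cost M\<close> the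
  cost of one iteration of a loop apart from its function calls.\<close>

definition step_cost :: "nat \<Rightarrow> nat" where "step_cost M = 20 * M + 100"
definition scan_cost :: "nat \<Rightarrow> nat" where "scan_cost M = step_cost M * M"
definition refutes_cost :: "nat \<Rightarrow> nat" where "refutes_cost M = (scan_cost M + step_cost M) * M"
definition compatible_cost :: "nat \<Rightarrow> nat" where
  "compatible_cost M = (refutes_cost M + step_cost M) * M"
definition extend_all_cost :: "nat \<Rightarrow> nat" where
  "extend_all_cost M = (scan_cost M + step_cost M) * M"
definition tuples_cost :: "nat \<Rightarrow> nat" where "tuples_cost M = (extend_all_cost M + step_cost M) * M"
definition unary_cost :: "nat \<Rightarrow> nat" where "unary_cost M = (2 * scan_cost M + step_cost M) * M"
definition edges_cost :: "nat \<Rightarrow> nat" where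
  "edges_cost M = (2 * compatible_cost M + 2 * scan_cost M + step_cost M) * M"
definition binary_cost :: "nat \<Rightarrow> nat" where "binary_cost M = (edges_cost M + step_cost M) * M"
definition facts_cost :: "nat \<Rightarrow> nat" where
  "facts_cost M = (binary_cost M + unary_cost M + step_cost M) * M"
definition pointed_cost :: "nat \<Rightarrow> nat" where
  "pointed_cost M = (compatible_cost M + scan_cost M + step_cost M) * M"

section \<open>Correctness and cost of the functions\<close>

context
  fixes M :: nat and K :: expr
begin

private abbreviation "computes \<equiv> computes_call (partner_program K)"

text \<open>The pattern for the loops below: the induction uses a bound proportional to the size of
  the consumed argument, which adds up along the recursion; afterwards this size is replaced by
  \<open>M\<close>.\<close>

lemma computes_member_aux:
  "tree_size L \<le> M \<Longrightarrow> tree_size c \<le> M \<Longrightarrow>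
     computes member_fn [L, c] (enc_bool (c \<in> set (elems L))) (step_cost M * tree_size L)"
proof (induction L)
  case Lf
  show ?case by (rule computes_callI) (simp_all add: member_body_def step_cost_def)
next
  case (Nd x L)
  then have "computes member_fn [L, c] (enc_bool (c \<in> set (elems L))) (step_cost M * tree_size L)"
    by simp
  from computes_callD[OF this] Nd.prems show ?case
    by (intro computes_callI) (auto simp: member_body_def step_cost_def algebra_simps)
qed

lemma computes_member:
  assumes "tree_size L \<le> M" "tree_size c \<le> M"
  shows "computes member_fn [L, c] (enc_bool (c \<in> set (elems L))) (scan_cost M)"
  using computes_member_aux[OF assms] by (rule computes_call_mono) (simp add: scan_cost_def assms)

lemma computes_refutes_aux:
  "tree_size L \<le> M \<Longrightarrow> tree_size q \<le> M \<Longrightarrow> computes refutes_fn [L, q] (enc_bool (refutes L q))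
     ((scan_cost M + step_cost M) * tree_size q)"
proof (induction L q rule: refutes.induct)
  case (1 L)
  then show ?case by (intro computes_callI) (simp_all add: refutes_body_def step_cost_def)
next
  case (2 L t r)
  let ?W = "scan_cost M + step_cost M"
  show ?case
  proof (cases "t = enc_tag 2")
    case True
    have "tree_size (left r) \<le> M" "tree_size (right r) \<le> M"
      using "2.prems"(2) tree_size_left_le[of r] tree_size_right_le[of r] by simp_all
    then have
      "computes refutes_fn [L, left r] (enc_bool (refutes L (left r))) (?W * tree_size (left r))"
      "computes refutes_fn [L, right r] (enc_bool (refutes L (right r))) (?W * tree_size (right r))"
      using 2 True by simp_all
    note calls = computes_callD[OF this(1)] computes_callD[OF this(2)]
    \<comment> \<open>The summand 1 is for \<open>r = Lf\<close>, where both parts are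
      \<open>Lf\<close>. The size 5 of the tag leaves room for it and for the cost of the current
      call.\<close>
    have "tree_size (left r) + tree_size (right r) \<le> tree_size r + 1" by (cases r) auto
    then have "?W * (tree_size (left r) + tree_size (right r)) \<le> ?W * (tree_size r + 1)"
      by (rule mult_le_mono2)
    moreover have "step_cost M * 1 \<le> ?W * 1" by simp
    ultimately show ?thesis using calls "2.prems" True
      by (intro computes_callI) (auto simp: refutes_body_def step_cost_def algebra_simps)
  next
    case False
    have "?W \<le> ?W * tree_size (Nd t r)" by simp
    with computes_callD[OF computes_member[OF "2.prems"]] "2.prems" False show ?thesis
      by (intro computes_callI) (auto simp: refutes_body_def step_cost_def)
  qed
qed

lemma computes_refutes:
  assumes "tree_size L \<le> M" "tree_size q \<le> M"
  shows "computes refutes_fn [L, q] (enc_bool (refutes L q)) (refutes_cost M)"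
  using computes_refutes_aux[OF assms]
  by (rule computes_call_mono) (unfold refutes_cost_def, intro mult_le_mono assms le_refl)

lemma computes_compatible_aux:
  "tree_size L \<le> M \<Longrightarrow> tree_size r \<le> M \<Longrightarrow> tree_size L' \<le> M \<Longrightarrow>
     computes compatible_fn [L, r, L'] (enc_bool (compatible r L L'))
       ((refutes_cost M + step_cost M) * tree_size L)"
proof (induction L)
  case Lf
  show ?case
    by (rule computes_callI) (simp_all add: compatible_body_def compatible_def step_cost_def Let_def)
next
  case (Nd c L)
  then have "computes compatible_fn [L, r, L'] (enc_bool (compatible r L L'))
    ((refutes_cost M + step_cost M) * tree_size L)" by simp
  note calls = computes_callD[OF this]
  have "tree_size (right (right c)) \<le> M"
    using Nd.prems(1) tree_size_right_le[of c] tree_size_right_le[of "right c"] by simp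
  from computes_callD[OF computes_refutes[OF Nd.prems(3) this]] calls Nd.prems show ?case
    by (intro computes_callI)
      (auto simp: compatible_body_def compatible_def step_cost_def Let_def algebra_simps)
qed

lemma computes_compatible:
  assumes "tree_size L \<le> M" "tree_size r \<le> M" "tree_size L' \<le> M"
  shows "computes compatible_fn [L, r, L'] (enc_bool (compatible r L L')) (compatible_cost M)"
  using computes_compatible_aux[OF assms]
  by (rule computes_call_mono) (unfold compatible_cost_def, intro mult_le_mono assms le_refl)

text \<open>By \<open>tree_size_ser_le\<close> the premise bounds the size of the output, and
  therefore of each accumulator passed on by an inner call.\<close>

lemma computes_ser_aux:
  "4 * tree_size t + tree_size (enc_name bs) \<le> M \<Longrightarrow>
     computes ser_fn [t, enc_name bs] (enc_name (ser t bs)) (step_cost M * tree_size t)"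
proof (induction t arbitrary: bs)
  case Lf
  then show ?case by (intro computes_callI) (simp_all add: ser_body_def step_cost_def)
next
  case (Nd s t)
  have "computes ser_fn [t, enc_name bs] (enc_name (ser t bs)) (step_cost M * tree_size t)"
    using Nd by simp
  moreover have "computes ser_fn [s, enc_name (ser t bs)] (enc_name (ser s (ser t bs)))
      (step_cost M * tree_size s)"
    using Nd tree_size_ser_le[of t bs] by simp
  moreover note tree_size_ser_le[of t bs]
  ultimately show ?case using Nd.prems
    by (intro computes_callI)
      (auto dest!: computes_callD simp: ser_body_def step_cost_def algebra_simps)
qed

lemma computes_ser:
  assumes "4 * tree_size t + 1 \<le> M"
  shows "computes ser_fn [t, Lf] (enc_name (ser t [])) (scan_cost M)"
proof -
  have "computes ser_fn [t, Lf] (enc_name (ser t [])) (step_cost M * tree_size t)"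
    using computes_ser_aux[of t "[]"] assms by simp
  then show ?thesis by (rule computes_call_mono) (use assms in \<open>simp add: scan_cost_def\<close>)
qed

lemma computes_subtrees_aux:
  "tree_size (enc_trees (subtrees t @ xs)) \<le> M \<Longrightarrow>
     computes subtrees_fn [t, enc_trees xs] (enc_trees (subtrees t @ xs)) (step_cost M * tree_size t)"
proof (induction t arbitrary: xs)
  case Lf
  then show ?case by (intro computes_callI) (simp_all add: subtrees_body_def step_cost_def)
next
  case (Nd s t)
  have "computes subtrees_fn [t, enc_trees xs] (enc_trees (subtrees t @ xs))
      (step_cost M * tree_size t)"
    using Nd by (simp add: tree_size_enc_list)
  moreover have "computes subtrees_fn [s, enc_trees (subtrees t @ xs)]
      (enc_trees (subtrees s @ subtrees t @ xs)) (step_cost M * tree_size s)"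
    using Nd by (simp add: tree_size_enc_list)
  moreover have "tree_size (enc_trees xs) \<le> M" "tree_size (Nd s t) \<le> M"
    using Nd.prems by (simp_all add: tree_size_enc_list)
  ultimately show ?case
    by (intro computes_callI)
      (auto dest!: computes_callD simp: subtrees_body_def step_cost_def algebra_simps)
qed

lemma computes_subtrees:
  assumes "tree_size (enc_trees (subtrees t)) \<le> M" "tree_size t \<le> M"
  shows "computes subtrees_fn [t, Lf] (enc_trees (subtrees t)) (scan_cost M)"
proof -
  have "computes subtrees_fn [t, Lf] (enc_trees (subtrees t)) (step_cost M * tree_size t)"
    using computes_subtrees_aux[of t "[]"] assms by simp
  then show ?thesis by (rule computes_call_mono) (use assms in \<open>simp add: scan_cost_def\<close>)
qed

lemma computes_extend_aux:
  "tree_size (enc_trees Ls) \<le> M \<Longrightarrow> tree_size x \<le> M \<Longrightarrow> tree_size (enc_trees Ls') \<le> M \<Longrightarrow>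
     computes extend_fn [enc_trees Ls, x, enc_trees Ls']
       (enc_trees (map (Nd x) Ls @ Ls')) (step_cost M * tree_size (enc_trees Ls))"
proof (induction Ls)
  case Nil
  then show ?case by (intro computes_callI) (simp_all add: extend_body_def step_cost_def)
next
  case (Cons L Ls)
  then have "computes extend_fn [enc_trees Ls, x, enc_trees Ls']
    (enc_trees (map (Nd x) Ls @ Ls')) (step_cost M * tree_size (enc_trees Ls))" by simp
  from computes_callD[OF this] Cons.prems show ?case
    by (intro computes_callI) (auto simp: extend_body_def step_cost_def algebra_simps)
qed

lemma computes_extend:
  assumes "tree_size (enc_trees Ls) \<le> M" "tree_size x \<le> M" "tree_size (enc_trees Ls') \<le> M"
  shows "computes extend_fn [enc_trees Ls, x, enc_trees Ls']
    (enc_trees (map (Nd x) Ls @ Ls')) (scan_cost M)"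
  using computes_extend_aux[OF assms] by (rule computes_call_mono) (simp add: scan_cost_def assms)

lemma computes_extend_all_aux:
  "tree_size (enc_trees Ls) \<le> M \<Longrightarrow> tree_size (enc_trees xs) \<le> M \<Longrightarrow>
   tree_size (enc_trees (concat (map (\<lambda>x. map (Nd x) Ls) xs))) \<le> M \<Longrightarrow>
     computes extend_all_fn [enc_trees xs, enc_trees Ls]
       (enc_trees (concat (map (\<lambda>x. map (Nd x) Ls) xs)))
       ((scan_cost M + step_cost M) * tree_size (enc_trees xs))"
proof (induction xs)
  case Nil
  then show ?case by (intro computes_callI) (simp_all add: extend_all_body_def step_cost_def)
next
  case (Cons x xs)
  have rest: "tree_size (enc_trees (concat (map (\<lambda>x. map (Nd x) Ls) xs))) \<le> M"
    using Cons.prems(3) by (simp add: tree_size_enc_list)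
  moreover have "tree_size x \<le> M" using Cons.prems(2) by simp
  note computes_callD[OF computes_extend[OF Cons.prems(1) this rest]]
  moreover have "computes extend_all_fn [enc_trees xs, enc_trees Ls]
       (enc_trees (concat (map (\<lambda>x. map (Nd x) Ls) xs)))
       ((scan_cost M + step_cost M) * tree_size (enc_trees xs))"
    using Cons rest by simp
  note computes_callD[OF this]
  ultimately show ?case using Cons.prems
    by (intro computes_callI) (auto simp: extend_all_body_def step_cost_def algebra_simps)
qed

lemma computes_extend_all:
  assumes "tree_size (enc_trees Ls) \<le> M" "tree_size (enc_trees xs) \<le> M"
    "tree_size (enc_trees (concat (map (\<lambda>x. map (Nd x) Ls) xs))) \<le> M"
  shows "computes extend_all_fn [enc_trees xs, enc_trees Ls]
       (enc_trees (concat (map (\<lambda>x. map (Nd x) Ls) xs))) (extend_all_cost M)"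
  using computes_extend_all_aux[OF assms]
  by (rule computes_call_mono) (unfold extend_all_cost_def, intro mult_le_mono assms le_refl)

text \<open>\<open>k\<close> acts as a unary counter. A bound is assumed for every \<open>j\<close>
  up to its length because the recursion builds all these lists.\<close>

lemma computes_tuples_aux:
  "tree_size k \<le> M \<Longrightarrow> tree_size (enc_trees xs) \<le> M \<Longrightarrow>
   (\<And>j. j \<le> length (elems k) \<Longrightarrow> tree_size (enc_trees (tuples j xs)) \<le> M) \<Longrightarrow>
     computes tuples_fn [k, enc_trees xs] (enc_trees (tuples (length (elems k)) xs))
       ((extend_all_cost M + step_cost M) * tree_size k)"
proof (induction k)
  case Lf
  then show ?case by (intro computes_callI) (simp_all add: tuples_body_def step_cost_def)
next
  case (Nd x k)
  let ?k = "length (elems k)"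
  have rec: "tree_size (enc_trees (tuples ?k xs)) \<le> M" using Nd.prems(3)[of ?k] by simp
  have "tree_size (enc_trees (concat (map (\<lambda>x. map (Nd x) (tuples ?k xs)) xs))) \<le> M"
    using Nd.prems(3)[of "Suc ?k"] by simp
  note computes_callD[OF computes_extend_all[OF rec Nd.prems(2) this]]
  moreover have "computes tuples_fn [k, enc_trees xs] (enc_trees (tuples ?k xs))
       ((extend_all_cost M + step_cost M) * tree_size k)"
    using Nd by simp
  note computes_callD[OF this]
  ultimately show ?case using Nd.prems(1,2)
    by (intro computes_callI) (auto simp: tuples_body_def step_cost_def algebra_simps)
qed

lemma computes_tuples:
  assumes "tree_size k \<le> M" "tree_size (enc_trees xs) \<le> M"
    "\<And>j. j \<le> length (elems k) \<Longrightarrow> tree_size (enc_trees (tuples j xs)) \<le> M"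
  shows "computes tuples_fn [k, enc_trees xs] (enc_trees (tuples (length (elems k)) xs))
    (tuples_cost M)"
  using computes_tuples_aux[OF assms]
  by (rule computes_call_mono) (auto simp: tuples_cost_def assms)

lemma computes_unary_aux:
  "tree_size (enc_trees Ls) \<le> M \<Longrightarrow> (\<And>L. L \<in> set Ls \<Longrightarrow> 4 * tree_size L + 1 \<le> M) \<Longrightarrow>
   tree_size (enc_query (Atom A)) \<le> M \<Longrightarrow> tree_size (enc_list enc_fact fs) \<le> M \<Longrightarrow>
     computes unary_fn [enc_trees Ls, enc_name A, enc_list enc_fact fs]
       (enc_list enc_fact (predicate_facts Ls (Unary A) @ fs))
       ((2 * scan_cost M + step_cost M) * tree_size (enc_trees Ls))"
proof (induction Ls)
  case Nil
  then show ?case by (intro computes_callI) (simp_all add: unary_body_def step_cost_def Let_def)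
next
  case (Cons L Ls)
  then have "computes unary_fn [enc_trees Ls, enc_name A, enc_list enc_fact fs]
       (enc_list enc_fact (predicate_facts Ls (Unary A) @ fs))
       ((2 * scan_cost M + step_cost M) * tree_size (enc_trees Ls))" by simp
  note computes_callD[OF this]
  moreover have L: "4 * tree_size L + 1 \<le> M" "tree_size L \<le> M" using Cons.prems(2)[of L] by simp_all
  note computes_callD[OF computes_ser[OF L(1)]]
    computes_callD[OF computes_member[OF L(2) Cons.prems(3)]]
  ultimately show ?case using Cons.prems(1,3,4)
    by (intro computes_callI) (auto simp: unary_body_def step_cost_def Let_def algebra_simps)
qed

lemma computes_unary:
  assumes "tree_size (enc_trees Ls) \<le> M" "\<And>L. L \<in> set Ls \<Longrightarrow> 4 * tree_size L + 1 \<le> M"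
    "tree_size (enc_query (Atom A)) \<le> M" "tree_size (enc_list enc_fact fs) \<le> M"
  shows "computes unary_fn [enc_trees Ls, enc_name A, enc_list enc_fact fs]
       (enc_list enc_fact (predicate_facts Ls (Unary A) @ fs)) (unary_cost M)"
  using computes_unary_aux[OF assms]
  by (rule computes_call_mono) (auto simp: unary_cost_def assms)

lemma computes_edges_aux:
  "tree_size (enc_trees Ls) \<le> M \<Longrightarrow> (\<And>L. L \<in> set Ls \<Longrightarrow> 4 * tree_size L + 1 \<le> M) \<Longrightarrow>
   4 * tree_size L0 + 1 \<le> M \<Longrightarrow>
   tree_size (enc_name P) + 4 \<le> M \<Longrightarrow> tree_size (enc_list enc_fact fs) \<le> M \<Longrightarrow>
     computes edges_fn [enc_trees Ls, enc_name P, L0, enc_list enc_fact fs]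
       (enc_list enc_fact ([BFact P (ser L0 []) (ser L []). L \<leftarrow> Ls, edge (Fwd P) L0 L] @ fs))
       ((2 * compatible_cost M + 2 * scan_cost M + step_cost M) * tree_size (enc_trees Ls))"
proof (induction Ls)
  case Nil
  then show ?case by (intro computes_callI) (simp_all add: edges_body_def step_cost_def Let_def)
next
  case (Cons L Ls)
  then have "computes edges_fn [enc_trees Ls, enc_name P, L0, enc_list enc_fact fs]
       (enc_list enc_fact ([BFact P (ser L0 []) (ser L []). L \<leftarrow> Ls, edge (Fwd P) L0 L] @ fs))
       ((2 * compatible_cost M + 2 * scan_cost M + step_cost M) * tree_size (enc_trees Ls))"
    by simp
  note computes_callD[OF this]
  moreover have L: "4 * tree_size L + 1 \<le> M" "tree_size L \<le> M" "tree_size L0 \<le> M"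
    using Cons.prems(2)[of L] Cons.prems(3) by simp_all
  note computes_callD[OF computes_ser[OF L(1)]] computes_callD[OF computes_ser[OF Cons.prems(3)]]
  \<comment> \<open>These trees are the encodings of \<open>Fwd P\<close> and of its
    inverse.\<close>
  moreover have P: "tree_size (Nd Lf (enc_name P)) \<le> M"
    "tree_size (Nd (enc_tag (Suc 0)) (enc_name P)) \<le> M"
    using Cons.prems(4) by simp_all
  note computes_callD[OF computes_compatible[OF L(3) P(1) L(2)]]
    computes_callD[OF computes_compatible[OF L(2) P(2) L(3)]]
  ultimately show ?case using Cons.prems(1,3-5)
    by (intro computes_callI)
      (auto simp: edges_body_def edge_def step_cost_def Let_def algebra_simps)
qed

lemma computes_edges:
  assumes "tree_size (enc_trees Ls) \<le> M" "\<And>L. L \<in> set Ls \<Longrightarrow> 4 * tree_size L + 1 \<le> M"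
    "4 * tree_size L0 + 1 \<le> M"
    "tree_size (enc_name P) + 4 \<le> M" "tree_size (enc_list enc_fact fs) \<le> M"
  shows "computes edges_fn [enc_trees Ls, enc_name P, L0, enc_list enc_fact fs]
       (enc_list enc_fact ([BFact P (ser L0 []) (ser L []). L \<leftarrow> Ls, edge (Fwd P) L0 L] @ fs))
       (edges_cost M)"
  using computes_edges_aux[OF assms]
  by (rule computes_call_mono) (auto simp: edges_cost_def assms)

text \<open>The outer loop consumes \<open>Ls\<close>, while the list of possible targets must stay
  complete; hence the separate \<open>Ls0\<close>.\<close>

lemma computes_binary_aux:
  "tree_size (enc_trees Ls) \<le> M \<Longrightarrow> (\<And>L. L \<in> set Ls \<Longrightarrow> 4 * tree_size L + 1 \<le> M) \<Longrightarrow>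
   tree_size (enc_trees Ls0) \<le> M \<Longrightarrow> (\<And>L. L \<in> set Ls0 \<Longrightarrow> 4 * tree_size L + 1 \<le> M) \<Longrightarrow>
   tree_size (enc_name P) + 4 \<le> M \<Longrightarrow>
   tree_size (enc_list enc_fact
     ([BFact P (ser L []) (ser L' []). L \<leftarrow> Ls, L' \<leftarrow> Ls0, edge (Fwd P) L L'] @ fs)) \<le> M \<Longrightarrow>
     computes binary_fn [enc_trees Ls, enc_name P, enc_trees Ls0, enc_list enc_fact fs]
       (enc_list enc_fact
         ([BFact P (ser L []) (ser L' []). L \<leftarrow> Ls, L' \<leftarrow> Ls0, edge (Fwd P) L L'] @ fs))
       ((edges_cost M + step_cost M) * tree_size (enc_trees Ls))"
proof (induction Ls)
  case Nil
  then show ?case by (intro computes_callI) (simp_all add: binary_body_def step_cost_def)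
next
  case (Cons L Ls)
  let ?rest = "[BFact P (ser L []) (ser L' []). L \<leftarrow> Ls, L' \<leftarrow> Ls0, edge (Fwd P) L L'] @ fs"
  have rest: "tree_size (enc_list enc_fact ?rest) \<le> M" and fs: "tree_size (enc_list enc_fact fs) \<le> M"
    using Cons.prems(6) by (simp_all add: tree_size_enc_list)
  have "computes binary_fn [enc_trees Ls, enc_name P, enc_trees Ls0, enc_list enc_fact fs]
       (enc_list enc_fact ?rest) ((edges_cost M + step_cost M) * tree_size (enc_trees Ls))"
    using Cons rest by simp
  note computes_callD[OF this]
  moreover have "4 * tree_size L + 1 \<le> M" using Cons.prems(2)[of L] by simp
  note computes_callD[OF computes_edges[OF Cons.prems(3,4) this Cons.prems(5) rest]]
  ultimately show ?case using Cons.prems(1,3,5) fs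
    by (intro computes_callI) (auto simp: binary_body_def step_cost_def algebra_simps)
qed

lemma computes_binary:
  assumes "tree_size (enc_trees Ls) \<le> M" "\<And>L. L \<in> set Ls \<Longrightarrow> 4 * tree_size L + 1 \<le> M"
    "tree_size (enc_name P) + 4 \<le> M"
    "tree_size (enc_list enc_fact (predicate_facts Ls (Binary P) @ fs)) \<le> M"
  shows "computes binary_fn [enc_trees Ls, enc_name P, enc_trees Ls, enc_list enc_fact fs]
    (enc_list enc_fact (predicate_facts Ls (Binary P) @ fs)) (binary_cost M)"
proof (rule computes_call_mono)
  show "computes binary_fn [enc_trees Ls, enc_name P, enc_trees Ls, enc_list enc_fact fs]
    (enc_list enc_fact (predicate_facts Ls (Binary P) @ fs))
    ((edges_cost M + step_cost M) * tree_size (enc_trees Ls))"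
    using computes_binary_aux[of Ls Ls P fs] assms by simp
qed (simp add: binary_cost_def assms)

lemma computes_facts_aux:
  "tree_size (enc_trees Ls) \<le> M \<Longrightarrow> (\<And>L. L \<in> set Ls \<Longrightarrow> 4 * tree_size L + 1 \<le> M) \<Longrightarrow>
   tree_size (enc_list enc_predicate ps) + 4 \<le> M \<Longrightarrow>
   tree_size (enc_list enc_fact (partner_facts Ls ps)) \<le> M \<Longrightarrow>
     computes facts_fn [enc_list enc_predicate ps, enc_trees Ls]
       (enc_list enc_fact (partner_facts Ls ps))
       ((binary_cost M + unary_cost M + step_cost M) * tree_size (enc_list enc_predicate ps))"
proof (induction ps)
  case Nil
  then show ?case
    by (intro computes_callI) (simp_all add: facts_body_def partner_facts_def step_cost_def Let_def)
next
  case (Cons p ps)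
  have rest: "tree_size (enc_list enc_fact (partner_facts Ls ps)) \<le> M"
    using Cons.prems(4) by (simp add: tree_size_enc_list partner_facts_def)
  have "computes facts_fn [enc_list enc_predicate ps, enc_trees Ls]
       (enc_list enc_fact (partner_facts Ls ps))
       ((binary_cost M + unary_cost M + step_cost M) * tree_size (enc_list enc_predicate ps))"
    using Cons rest by simp
  note rec = computes_callD[OF this]
  have facts: "partner_facts Ls (p # ps) = predicate_facts Ls p @ partner_facts Ls ps"
    by (simp add: partner_facts_def)
  show ?case
  proof (cases p)
    case (Unary A)
    then have "tree_size (enc_query (Atom A)) \<le> M" using Cons.prems(3) by simp
    from computes_callD[OF computes_unary[OF Cons.prems(1,2) this rest]] rec Cons.prems(1,3) Unary
    show ?thesis unfolding facts
      by (intro computes_callI)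
        (auto simp: facts_body_def step_cost_def Let_def algebra_simps
          simp del: predicate_facts.simps)
  next
    case (Binary P)
    then have P: "tree_size (enc_name P) + 4 \<le> M" using Cons.prems(3) by simp
    have "tree_size (enc_list enc_fact (predicate_facts Ls (Binary P) @ partner_facts Ls ps)) \<le> M"
      using Cons.prems(4) unfolding facts by (simp only: Binary)
    from computes_callD[OF computes_binary[OF Cons.prems(1,2) P this]] rec Cons.prems(1,3) Binary
    show ?thesis unfolding facts
      by (intro computes_callI)
        (auto simp: facts_body_def step_cost_def Let_def algebra_simps
          simp del: predicate_facts.simps)
  qed
qed

lemma computes_facts:
  assumes "tree_size (enc_trees Ls) \<le> M" "\<And>L. L \<in> set Ls \<Longrightarrow> 4 * tree_size L + 1 \<le> M"
    "tree_size (enc_list enc_predicate ps) + 4 \<le> M"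
    "tree_size (enc_list enc_fact (partner_facts Ls ps)) \<le> M"
  shows "computes facts_fn [enc_list enc_predicate ps, enc_trees Ls]
       (enc_list enc_fact (partner_facts Ls ps)) (facts_cost M)"
  using computes_facts_aux[OF assms]
  by (rule computes_call_mono) (use assms(3) in \<open>auto simp: facts_cost_def\<close>)

lemma computes_refutes_all_aux:
  "tree_size L \<le> M \<Longrightarrow> tree_size (enc_list enc_query qs) \<le> M \<Longrightarrow>
     computes refutes_all_fn [enc_list enc_query qs, L]
       (enc_bool (\<forall>q \<in> set qs. refutes L (enc_query q)))
       ((refutes_cost M + step_cost M) * tree_size (enc_list enc_query qs))"
proof (induction qs)
  case Nil
  then show ?case by (intro computes_callI) (simp_all add: refutes_all_body_def step_cost_def)
next
  case (Cons q qs)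
  then have "computes refutes_all_fn [enc_list enc_query qs, L]
       (enc_bool (\<forall>q \<in> set qs. refutes L (enc_query q)))
       ((refutes_cost M + step_cost M) * tree_size (enc_list enc_query qs))" by simp
  note computes_callD[OF this]
  moreover have "tree_size (enc_query q) \<le> M" using Cons.prems(2) by simp
  note computes_callD[OF computes_refutes[OF Cons.prems(1) this]]
  ultimately show ?case using Cons.prems
    by (intro computes_callI) (auto simp: refutes_all_body_def step_cost_def algebra_simps)
qed

text \<open>As in \<open>compatible_fn\<close>, there is at most one call of
  \<open>refutes_fn\<close> per list element, so the same cost bound serves.\<close>

lemma computes_refutes_all:
  assumes "tree_size L \<le> M" "tree_size (enc_list enc_query qs) \<le> M"
  shows "computes refutes_all_fn [enc_list enc_query qs, L]
       (enc_bool (\<forall>q \<in> set qs. refutes L (enc_query q))) (compatible_cost M)"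
  using computes_refutes_all_aux[OF assms]
  by (rule computes_call_mono) (unfold compatible_cost_def, intro mult_le_mono assms le_refl)

lemma computes_pointed_aux:
  "tree_size (enc_trees Ls) \<le> M \<Longrightarrow> (\<And>L. L \<in> set Ls \<Longrightarrow> 4 * tree_size L + 1 \<le> M) \<Longrightarrow>
   tree_size (enc_list enc_query qs) \<le> M \<Longrightarrow> tree_size (enc_list enc_fact fs) \<le> M \<Longrightarrow>
     computes pointed_fn [enc_trees Ls, enc_list enc_query qs, enc_list enc_fact fs]
       (enc_list enc_pointed [(fs, ser L []). L \<leftarrow> Ls, \<forall>q \<in> set qs. refutes L (enc_query q)])
       ((compatible_cost M + scan_cost M + step_cost M) * tree_size (enc_trees Ls))"
proof (induction Ls)
  case Nil
  then show ?case by (intro computes_callI) (simp_all add: pointed_body_def step_cost_def Let_def)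
next
  case (Cons L Ls)
  then have "computes pointed_fn [enc_trees Ls, enc_list enc_query qs, enc_list enc_fact fs]
       (enc_list enc_pointed [(fs, ser L []). L \<leftarrow> Ls, \<forall>q \<in> set qs. refutes L (enc_query q)])
       ((compatible_cost M + scan_cost M + step_cost M) * tree_size (enc_trees Ls))" by simp
  note computes_callD[OF this]
  moreover have L: "4 * tree_size L + 1 \<le> M" "tree_size L \<le> M" using Cons.prems(2)[of L] by simp_all
  note computes_callD[OF computes_ser[OF L(1)]]
    computes_callD[OF computes_refutes_all[OF L(2) Cons.prems(3)]]
  ultimately show ?case using Cons.prems(1,3,4)
    by (intro computes_callI)
      (auto simp: pointed_body_def enc_pointed_def step_cost_def Let_def algebra_simps)
qed

lemma computes_pointed:
  assumes "tree_size (enc_trees Ls) \<le> M" "\<And>L. L \<in> set Ls \<Longrightarrow> 4 * tree_size L + 1 \<le> M"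
    "tree_size (enc_list enc_query qs) \<le> M" "tree_size (enc_list enc_fact fs) \<le> M"
  shows "computes pointed_fn [enc_trees Ls, enc_list enc_query qs, enc_list enc_fact fs]
    (enc_list enc_pointed [(fs, ser L []). L \<leftarrow> Ls, \<forall>q \<in> set qs. refutes L (enc_query q)])
    (pointed_cost M)"
  using computes_pointed_aux[OF assms]
  by (rule computes_call_mono) (auto simp: pointed_cost_def assms)

lemma runs_partner_program:
  fixes ps qs
  defines "x \<equiv> Nd (enc_list enc_predicate ps) (enc_list enc_query qs)"
  defines "xs \<equiv> subtrees (enc_list enc_query qs)"
  defines "env \<equiv> [enc_list enc_predicate ps, enc_list enc_query qs, enc_trees xs]"
  assumes K: "expr_halts (partner_program K) env K" "expr_val (partner_program K) env K = k"
    "expr_cost (partner_program K) env K \<le> M + 1"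
  defines "Ls \<equiv> tuples (length (elems k)) xs"
  assumes k: "tree_size k \<le> M" and x: "tree_size x + 4 \<le> M"
    and xs: "tree_size (enc_trees xs) \<le> M"
    and tuples: "\<And>j. j \<le> length (elems k) \<Longrightarrow> tree_size (enc_trees (tuples j xs)) \<le> M"
    and Ls: "\<And>L. L \<in> set Ls \<Longrightarrow> 4 * tree_size L + 1 \<le> M"
    and facts: "tree_size (enc_list enc_fact (partner_facts Ls ps)) \<le> M"
  shows "\<exists>t \<le> scan_cost M + tuples_cost M + facts_cost M + pointed_cost M + step_cost M.
    runs (partner_program K) x (enc_list enc_pointed (partner Ls ps qs)) t"
proof -
  have ps: "tree_size (enc_list enc_predicate ps) + 4 \<le> M"
    and qs: "tree_size (enc_list enc_query qs) \<le> M"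
    using x by (simp_all add: x_def)
  have Ls_le: "tree_size (enc_trees Ls) \<le> M" using tuples by (simp add: Ls_def)
  let ?result_cost = "facts_cost M + pointed_cost M + 5 * M + 20"
  have result: "computes result_fn [enc_list enc_predicate ps, enc_list enc_query qs, enc_trees Ls]
      (enc_list enc_pointed (partner Ls ps qs)) ?result_cost"
    using computes_callD[OF computes_facts[OF Ls_le Ls ps facts]]
      computes_callD[OF computes_pointed[OF Ls_le Ls qs facts]] ps qs Ls_le
    by (intro computes_callI) (auto simp: result_body_def partner_def)
  let ?nodes_cost = "tuples_cost M + ?result_cost + 5 * M + 20"
  have nodes: "computes nodes_fn env (enc_list enc_pointed (partner Ls ps qs)) ?nodes_cost"
    using computes_callD[OF computes_tuples[OF k xs tuples]] computes_callD[OF result] ps qs xs K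
    by (intro computes_callI) (auto simp: nodes_body_def env_def Ls_def[symmetric])
  have "computes main_fn [x] (enc_list enc_pointed (partner Ls ps qs))
      (scan_cost M + ?nodes_cost + 5 * M + 20)"
    using computes_callD[OF computes_subtrees[OF xs[unfolded xs_def] qs]] computes_callD[OF nodes] x
    by (intro computes_callI) (auto simp: main_body_def x_def env_def xs_def)
  then obtain t where t: "t \<le> scan_cost M + ?nodes_cost + 5 * M + 20"
    "eval (partner_program K) [x] main_body (enc_list enc_pointed (partner Ls ps qs)) t"
    by (auto simp: computes_call_def)
  have "eval (partner_program K) [x] (Call main_fn [Var 0]) (enc_list enc_pointed (partner Ls ps qs))
      (1 + sum_list [1 + tree_size x] + t)"
    using t(2) eval_Var[of 0 "[x]"] by (intro eval_Call[where vs = "[x]"]) auto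
  \<comment> \<open>\<open>step_cost M\<close> absorbs the three overheads \<open>5 * M + 20\<close>
    and the cost of the initial call.\<close>
  then show ?thesis using t(1) x unfolding runs_def step_cost_def 
    by (intro exI[of _ "1 + sum_list [1 + tree_size x] + t"]) auto
qed

end

section \<open>Time bounds\<close>

lemma tree_size_enc_list_le:
  assumes "\<And>x. x \<in> set xs \<Longrightarrow> tree_size (f x) \<le> b"
  shows "tree_size (enc_list f xs) \<le> 1 + length xs * (1 + b)"
  using assms
proof (induction xs)
  case (Cons x xs)
  then have "tree_size (f x) \<le> b" "tree_size (enc_list f xs) \<le> 1 + length xs * (1 + b)" by simp_all
  then show ?case by simp
qed simp

lemma length_le_tree_size_enc_list: "length xs \<le> tree_size (enc_list f xs)"
  by (induction xs) auto

lemma tree_size_in_enc_list: "x \<in> set xs \<Longrightarrow> tree_size (f x) \<le> tree_size (enc_list f xs)"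
  by (induction xs) auto

lemma length_subtrees_le: "length (subtrees t) \<le> tree_size t"
  by (induction t) auto

lemma tree_size_subtrees_le: "u \<in> set (subtrees t) \<Longrightarrow> tree_size u \<le> tree_size t"
  by (induction t) auto

text \<open>With \<open>m = length xs\<close>, the induction step is
  \<open>1 + m * (m + 1) ^ k \<le> (m + 1) ^ Suc k\<close>.\<close>

lemma length_tuples_le: "length (tuples k xs) \<le> (length xs + 1) ^ k"
proof (induction k)
  case (Suc k)
  have "length (tuples (Suc k) xs) = 1 + length xs * length (tuples k xs)"
    by (simp add: length_concat comp_def sum_list_triv)
  also have "\<dots> \<le> (length xs + 1) ^ k + length xs * (length xs + 1) ^ k"
    using Suc by (intro add_mono mult_le_mono2) auto
  finally show ?case by simp
qed simp

lemma length_predicate_facts_le: "length (predicate_facts Ls p) \<le> length Ls * length Ls"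
proof (cases p)
  case (Unary A)
  have "length (predicate_facts Ls p) \<le> length Ls"
    unfolding Unary by (induction Ls) auto
  then show ?thesis using le_square le_trans by blast
next
  case (Binary P)
  have "length [BFact P (ser L []) (ser L' []). L' \<leftarrow> Ls', edge (Fwd P) L L'] \<le> length Ls'" for L Ls'
    by (induction Ls') auto
  then have "length [BFact P (ser L []) (ser L' []). L \<leftarrow> Ls, L' \<leftarrow> Ls', edge (Fwd P) L L']
      \<le> length Ls * length Ls'" for Ls'
    by (induction Ls) (auto intro: add_mono)
  then show ?thesis unfolding Binary predicate_facts.simps .
qed

lemma length_partner_facts_le: "length (partner_facts Ls ps) \<le> length ps * (length Ls * length Ls)"
  using length_predicate_facts_le[of Ls]
  by (induction ps) (auto simp: partner_facts_def intro: add_mono)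

lemma tree_size_partner_fact_le:
  assumes "\<phi> \<in> set (partner_facts Ls ps)"
    and L: "\<And>L. L \<in> set Ls \<Longrightarrow> 4 * tree_size L + 1 \<le> b"
  shows "tree_size (enc_fact \<phi>) \<le> 6 + tree_size (enc_list enc_predicate ps) + 2 * b"
proof -
  have name: "tree_size (enc_name (ser L [])) \<le> b" if "L \<in> set Ls" for L
    using tree_size_ser_le[of L "[]"] L[OF that] by simp
  show ?thesis
  proof (cases \<phi>)
    case (UFact A a)
    with assms(1) obtain L where "Unary A \<in> set ps" "L \<in> set Ls" "a = ser L []"
      by (auto simp: UFact_in_partner_facts)
    with name tree_size_in_enc_list[of "Unary A" ps enc_predicate] UFact show ?thesis by fastforce
  next
    case (BFact P a b)
    with assms(1) obtain L L' where "Binary P \<in> set ps" "L \<in> set Ls" "a = ser L []"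
      "L' \<in> set Ls" "b = ser L' []"
      by (auto simp: BFact_in_partner_facts)
    with name[of L] name[of L'] tree_size_in_enc_list[of "Binary P" ps enc_predicate] BFact
    show ?thesis by simp
  qed
qed

section \<open>Running times as powers\<close>

text \<open>Each level of nesting multiplies by \<open>M\<close>, and a further factor
  \<open>M\<close> absorbs the coefficients, which sum to at most 5. So the exponent grows by 2 per
  level, from 3 for \<open>scan_cost\<close> to 13 for \<open>facts_cost\<close>, and the final sum
  adds 1.\<close>

lemma total_cost_le:
  assumes "M \<ge> 200"
  shows "scan_cost M + tuples_cost M + facts_cost M + pointed_cost M + step_cost M \<le> M ^ 14"
proof -
  have absorb: "t \<le> M ^ (n + 1)" if "t \<le> 5 * M ^ n" for t n
  proof -
    have "5 * M ^ n \<le> M * M ^ n" using assms by (intro mult_le_mono1) simp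
    with that have "t \<le> M * M ^ n" by (rule le_trans)
    then show ?thesis by simp
  qed
  have loop: "t * M \<le> M ^ (n + 2)" if "t \<le> 5 * M ^ n" for t n
    using mult_le_mono1[OF absorb[OF that], of M] by (simp add: mult_ac)
  have le: "t \<le> M ^ n" if "t \<le> M ^ m" "m \<le> n" for t m n
  proof -
    have "M ^ m \<le> M ^ n" using that(2) assms by (intro power_increasing) auto
    then show ?thesis using that(1) by linarith
  qed
  have "200 * M \<le> M * M" using assms by (intro mult_le_mono1)
  then have step: "step_cost M \<le> M ^ 2"
    using assms unfolding step_cost_def power2_eq_square by linarith
  have scan: "scan_cost M \<le> M ^ 3"
    using mult_le_mono1[OF step, of M] by (simp add: scan_cost_def numeral_eq_Suc mult_ac)
  have "scan_cost M + step_cost M \<le> 5 * M ^ 3"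
    using le[OF scan, of 3] le[OF step, of 3] by simp
  then have refutes: "refutes_cost M \<le> M ^ 5"
    using loop[of _ 3] by (simp add: refutes_cost_def)
  have "refutes_cost M + step_cost M \<le> 5 * M ^ 5"
    using le[OF refutes, of 5] le[OF step, of 5] by simp
  then have compatible: "compatible_cost M \<le> M ^ 7"
    using loop[of _ 5] by (simp add: compatible_cost_def)
  have "scan_cost M + step_cost M \<le> 5 * M ^ 3"
    using le[OF scan, of 3] le[OF step, of 3] by simp
  then have extend_all: "extend_all_cost M \<le> M ^ 5"
    using loop[of _ 3] by (simp add: extend_all_cost_def)
  have "extend_all_cost M + step_cost M \<le> 5 * M ^ 5"
    using le[OF extend_all, of 5] le[OF step, of 5] by simp
  then have tuples: "tuples_cost M \<le> M ^ 7"
    using loop[of _ 5] by (simp add: tuples_cost_def)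
  have "2 * scan_cost M + step_cost M \<le> 5 * M ^ 3"
    using le[OF scan, of 3] le[OF step, of 3] by simp
  then have unary: "unary_cost M \<le> M ^ 5"
    using loop[of _ 3] by (simp add: unary_cost_def)
  have "2 * compatible_cost M + 2 * scan_cost M + step_cost M \<le> 5 * M ^ 7"
    using le[OF compatible, of 7] le[OF scan, of 7] le[OF step, of 7] by simp
  then have edges: "edges_cost M \<le> M ^ 9"
    using loop[of _ 7] by (simp add: edges_cost_def)
  have "edges_cost M + step_cost M \<le> 5 * M ^ 9"
    using le[OF edges, of 9] le[OF step, of 9] by simp
  then have binary: "binary_cost M \<le> M ^ 11"
    using loop[of _ 9] by (simp add: binary_cost_def)
  have "binary_cost M + unary_cost M + step_cost M \<le> 5 * M ^ 11"
    using le[OF binary, of 11] le[OF unary, of 11] le[OF step, of 11] by simp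
  then have facts: "facts_cost M \<le> M ^ 13"
    using loop[of _ 11] by (simp add: facts_cost_def)
  have "compatible_cost M + scan_cost M + step_cost M \<le> 5 * M ^ 7"
    using le[OF compatible, of 7] le[OF scan, of 7] le[OF step, of 7] by simp
  then have pointed: "pointed_cost M \<le> M ^ 9"
    using loop[of _ 7] by (simp add: pointed_cost_def)
  have "scan_cost M + tuples_cost M + facts_cost M + pointed_cost M + step_cost M \<le> 5 * M ^ 13"
    using le[OF scan, of 13] le[OF tuples, of 13] facts le[OF pointed, of 13] le[OF step, of 13] by simp
  then show ?thesis using absorb[of _ 13] by simp
qed

lemma runs_partner_program_power:
  fixes ps qs
  defines "x \<equiv> Nd (enc_list enc_predicate ps) (enc_list enc_query qs)"
  defines "xs \<equiv> subtrees (enc_list enc_query qs)"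
  defines "env \<equiv> [enc_list enc_predicate ps, enc_list enc_query qs, enc_trees xs]"
  assumes K: "expr_halts (partner_program K) env K" "expr_val (partner_program K) env K = c"
    "expr_cost (partner_program K) env K \<le> tree_size c + 1"
  defines "k \<equiv> length (elems c)"
  assumes X: "tree_size x + k + 20 \<le> X" and c: "tree_size c \<le> X ^ 2"
  shows "\<exists>t \<le> X ^ ((2 * k + 5) * 14).
    runs (partner_program K) x (enc_list enc_pointed (partner (tuples k xs) ps qs)) t"
proof -
  define s where "s = tree_size x"
  \<comment> \<open>The largest value is the list of facts: at most \<open>s * X ^ (2 * k)\<close>
    facts, for \<open>X ^ k\<close> individuals, each of size at most \<open>X ^ 3\<close>. This
    fits into \<open>X ^ (2 * k + 5)\<close>.\<close>
  define M where "M = X ^ (2 * k + 5)"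
  have s: "tree_size (enc_list enc_predicate ps) + 1 \<le> s" "tree_size (enc_list enc_query qs) \<le> s"
    using tree_size_pos[of "enc_list enc_query qs"] by (simp_all add: s_def x_def)
  have X': "s + k + 20 \<le> X" using X by (simp add: s_def)
  then have pow: "X ^ i \<le> X ^ j" if "i \<le> j" for i j using that by (intro power_increasing) auto
  have M: "X ^ i \<le> M" if "i \<le> 2 * k + 5" for i using pow[OF that] by (simp add: M_def)
  have XX: "20 * X \<le> X ^ 2" "20 * X ^ 2 \<le> X ^ 3" "20 * X ^ 3 \<le> X ^ 4"
  proof -
    have "20 * X ^ i \<le> X * X ^ i" for i using X' by (intro mult_le_mono1) simp
    from this[of 1] this[of 2] this[of 3] show "20 * X \<le> X ^ 2" "20 * X ^ 2 \<le> X ^ 3" "20 * X ^ 3 \<le> X ^ 4"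
      by (simp_all add: numeral_eq_Suc)
  qed
  have xs_le: "length xs \<le> s" "\<And>u. u \<in> set xs \<Longrightarrow> tree_size u \<le> s"
    using length_subtrees_le[of "enc_list enc_query qs"]
      tree_size_subtrees_le[of _ "enc_list enc_query qs"] s(2) by (auto simp: xs_def intro: le_trans)
  have sX: "1 + (s + k) * (1 + s) \<le> X ^ 2"
  proof -
    have "1 + (s + k) * (1 + s) \<le> (s + k + 20) * (s + k + 20)" by (simp add: algebra_simps)
    also have "\<dots> \<le> X * X" using X' by (intro mult_le_mono)
    finally show ?thesis by (simp add: power2_eq_square)
  qed
  have enc_xs: "tree_size (enc_trees xs) \<le> X ^ 2"
  proof -
    have "tree_size (enc_trees xs) \<le> 1 + length xs * (1 + s)"
      using xs_le(2) by (intro tree_size_enc_list_le)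
    also have "\<dots> \<le> 1 + (s + k) * (1 + s)" using xs_le(1) by (intro add_mono mult_le_mono) auto
    finally show ?thesis using sX by linarith
  qed
  have tuple: "tree_size L \<le> X ^ 2" if "L \<in> set (tuples j xs)" "j \<le> k" for L j
  proof -
    have L: "length (elems L) \<le> j" "\<And>u. u \<in> set (elems L) \<Longrightarrow> tree_size u \<le> s"
      using that(1) xs_le(2) by (auto simp: set_tuples)
    have "tree_size L = tree_size (enc_trees (elems L))" by simp
    also have "\<dots> \<le> 1 + length (elems L) * (1 + s)" using L(2) by (intro tree_size_enc_list_le)
    also have "\<dots> \<le> 1 + (s + k) * (1 + s)" using L(1) that(2) by (intro add_mono mult_le_mono) auto
    finally show ?thesis using sX by linarith
  qed
  have length_tuples: "length (tuples j xs) \<le> X ^ k" if "j \<le> k" for j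
  proof -
    have "length (tuples j xs) \<le> (length xs + 1) ^ j" by (rule length_tuples_le)
    also have "\<dots> \<le> X ^ j" using xs_le(1) X' by (intro power_mono) auto
    finally show ?thesis using pow[OF that] by linarith
  qed
  have tuples: "tree_size (enc_trees (tuples j xs)) \<le> M" if "j \<le> k" for j
  proof -
    have "tree_size (enc_trees (tuples j xs)) \<le> 1 + length (tuples j xs) * (1 + X ^ 2)"
      using tuple that by (intro tree_size_enc_list_le) blast
    also have "\<dots> \<le> X ^ k + X ^ k * (1 + X ^ 2)"
      using length_tuples[OF that] X' by (intro add_mono mult_le_mono) auto
    also have "\<dots> = X ^ k * (2 + X ^ 2)" by (simp add: algebra_simps)
    also have "\<dots> \<le> X ^ k * X ^ 3" using XX X' by (intro mult_le_mono2) linarith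
    also have "\<dots> = X ^ (k + 3)" by (simp add: power_add)
    also have "\<dots> \<le> M" by (rule M) simp
    finally show ?thesis .
  qed
  have node: "4 * tree_size L + 1 \<le> 4 * X ^ 2 + 1" if "L \<in> set (tuples k xs)" for L
    using tuple[OF that] by simp
  have "tree_size (enc_fact \<phi>) \<le> X ^ 3" if "\<phi> \<in> set (partner_facts (tuples k xs) ps)" for \<phi>
  proof -
    have "tree_size (enc_fact \<phi>) \<le> 6 + tree_size (enc_list enc_predicate ps) + 2 * (4 * X ^ 2 + 1)"
      using that node by (rule tree_size_partner_fact_le)
    also have "\<dots> \<le> (s + 8) + 8 * X ^ 2" using s(1) by simp
    also have "\<dots> \<le> X ^ 2 + 8 * X ^ 2" using XX(1) X' by (intro add_mono le_refl) linarith
    also have "\<dots> \<le> 20 * X ^ 2" by simp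
    also have "\<dots> \<le> X ^ 3" by (rule XX)
    finally show ?thesis .
  qed
  then have "tree_size (enc_list enc_fact (partner_facts (tuples k xs) ps)) \<le>
      1 + length (partner_facts (tuples k xs) ps) * (1 + X ^ 3)"
    by (rule tree_size_enc_list_le)
  also have "\<dots> \<le> 1 + s * (X ^ k * X ^ k) * (1 + X ^ 3)"
  proof -
    have "length ps \<le> s" using length_le_tree_size_enc_list[of ps enc_predicate] s(1) by linarith
    moreover have "length (tuples k xs) * length (tuples k xs) \<le> X ^ k * X ^ k"
      using length_tuples[of k] by (intro mult_le_mono) auto
    ultimately have "length (partner_facts (tuples k xs) ps) \<le> s * (X ^ k * X ^ k)"
      using length_partner_facts_le[of "tuples k xs" ps] mult_le_mono le_trans by blast
    then show ?thesis by (intro add_mono mult_le_mono) auto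
  qed
  also have "\<dots> \<le> X ^ k * X ^ k + s * (X ^ k * X ^ k) * (1 + X ^ 3)"
    using X' by simp
  also have "\<dots> = (X ^ k * X ^ k) * (1 + s * (1 + X ^ 3))" by (simp add: algebra_simps)
  also have "\<dots> \<le> (X ^ k * X ^ k) * X ^ 5"
  proof (rule mult_le_mono2)
    have "1 + s * (1 + X ^ 3) \<le> 1 + X * (1 + X ^ 3)" using X' by (intro add_mono mult_le_mono) auto
    also have "\<dots> = 1 + X + X ^ 4" by (simp add: numeral_eq_Suc)
    also have "\<dots> \<le> 20 * X ^ 4" using pow[of 1 4] X' by simp
    also have "\<dots> \<le> X * X ^ 4" using X' by (intro mult_le_mono1) simp
    finally show "1 + s * (1 + X ^ 3) \<le> X ^ 5" by (simp add: numeral_eq_Suc)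
  qed
  also have "\<dots> = M" unfolding M_def mult_2 power_add by (rule refl)
  finally have facts: "tree_size (enc_list enc_fact (partner_facts (tuples k xs) ps)) \<le> M" .
  have M2: "X ^ 2 \<le> M" and M3: "X ^ 3 \<le> M" by (auto intro: M)
  have "\<exists>t \<le> scan_cost M + tuples_cost M + facts_cost M + pointed_cost M + step_cost M.
      runs (partner_program K) x (enc_list enc_pointed (partner (tuples k xs) ps qs)) t"
    unfolding x_def xs_def k_def
  proof (rule runs_partner_program)
    show "expr_halts (partner_program K) [enc_list enc_predicate ps, enc_list enc_query qs,
        enc_trees (subtrees (enc_list enc_query qs))] K"
      "expr_val (partner_program K) [enc_list enc_predicate ps, enc_list enc_query qs,
        enc_trees (subtrees (enc_list enc_query qs))] K = c"
      using K(1,2) by (simp_all add: env_def xs_def)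
    show "expr_cost (partner_program K) [enc_list enc_predicate ps, enc_list enc_query qs,
        enc_trees (subtrees (enc_list enc_query qs))] K \<le> M + 1"
      using K(3) c M2 by (simp add: env_def xs_def)
    show "tree_size c \<le> M" using c M2 by simp
    show "tree_size (Nd (enc_list enc_predicate ps) (enc_list enc_query qs)) + 4 \<le> M"
      using X XX M2 unfolding x_def by linarith
    show "tree_size (enc_trees (subtrees (enc_list enc_query qs))) \<le> M"
      using enc_xs M2 by (simp add: xs_def)
    show "tree_size (enc_trees (tuples j (subtrees (enc_list enc_query qs)))) \<le> M"
      if "j \<le> length (elems c)" for j
      using tuples that by (simp add: xs_def k_def)
    show "4 * tree_size L + 1 \<le> M"
      if "L \<in> set (tuples (length (elems c)) (subtrees (enc_list enc_query qs)))" for L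
      using node[of L] that XX X' M3 by (simp add: xs_def k_def)
    show "tree_size (enc_list enc_fact (partner_facts
        (tuples (length (elems c)) (subtrees (enc_list enc_query qs))) ps)) \<le> M"
      using facts by (simp add: xs_def k_def)
  qed
  moreover have "M \<ge> 200" using XX X' M2 by linarith
  note total_cost_le[OF this]
  moreover have "M ^ 14 = X ^ ((2 * k + 5) * 14)" unfolding M_def by (rule power_mult[symmetric])
  ultimately show ?thesis by (metis le_trans)
qed

lemma encodes_output_partner:
  "encodes_output ((\<lambda>(fs, a). (set fs, a)) ` set (partner Ls ps qs))
     (enc_list enc_pointed (partner Ls ps qs))"
  unfolding encodes_output_def by blast

lemma length_elems_enc_tag: "length (elems (enc_tag n)) = n"
  by (induction n) (auto simp: enc_tag_def)

text \<open>The bound \<open>n\<close> is hard-wired into the program as a constant counter, so the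
  exponent is constant too and the base \<open>m + n + 20\<close> gives a polynomial.\<close>

lemma EL_split_partners:
  "computes_split_partners EL (\<lambda>Q. card Q \<le> n) (\<lambda>m. poly ([:n + 20, 1:] ^ ((2 * n + 5) * 14)) m)
     (partner_program (TagE n))"
  unfolding computes_split_partners_def
proof (intro allI impI, elim conjE)
  fix \<Sigma> Q x
  assume Q: "Q \<subseteq> EL \<Sigma>" "card Q \<le> n" and "encodes_input \<Sigma> Q x"
  then obtain ps qs where in_out: "distinct qs" "\<Sigma> = set ps" "Q = set qs"
      "x = Nd (enc_list enc_predicate ps) (enc_list enc_query qs)"
    unfolding encodes_input_def by blast
  let ?Ls = "tuples n (subtrees (enc_list enc_query qs))"
  have "2 * n + 1 \<le> (tree_size x + n + 20) ^ 2" by (simp add: power2_eq_square algebra_simps)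
  then have "\<exists>t \<le> (tree_size x + n + 20) ^ ((2 * n + 5) * 14).
      runs (partner_program (TagE n)) x (enc_list enc_pointed (partner ?Ls ps qs)) t"
    using runs_partner_program_power[of "TagE n" ps qs "enc_tag n" "tree_size x + n + 20"]
    by (simp add: in_out length_elems_enc_tag)
  moreover have "(tree_size x + n + 20) ^ ((2 * n + 5) * 14) =
      poly ([:n + 20, 1:] ^ ((2 * n + 5) * 14)) (tree_size x)"
    by (simp add: poly_power algebra_simps)
  moreover have "split_partner EL \<Sigma> Q ((\<lambda>(fs, a). (set fs, a)) ` set (partner ?Ls ps qs))"
    unfolding in_out(2,3)
  proof (rule split_partner_partner, rule EL_partner_complete)
    show "length qs \<le> n" using Q(2) in_out(1,3) by (simp add: distinct_card)
    show "inverse_free q" if "q \<in> set qs" for q using that Q(1) in_out(3) by (auto simp: EL_def)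
  qed auto
  ultimately show "\<exists>y t \<S>. runs (partner_program (TagE n)) x y t \<and>
      t \<le> poly ([:n + 20, 1:] ^ ((2 * n + 5) * 14)) (tree_size x) \<and>
      encodes_output \<S> y \<and> split_partner EL \<Sigma> Q \<S>"
    by (metis encodes_output_partner)
qed

text \<open>The list of subtrees serves as its own counter. Its length is at most the input size, so
  the exponent is linear in the input size.\<close>

lemma ELI_split_partners:
  "computes_split_partners ELI (\<lambda>Q. True) (\<lambda>m. 2 ^ poly ([:20, 2:] * [:70, 28:]) m)
     (partner_program (Var 2))"
  unfolding computes_split_partners_def
proof (intro allI impI, elim conjE)
  fix \<Sigma> Q x
  assume "encodes_input \<Sigma> Q x"
  then obtain ps qs where in_out: "\<Sigma> = set ps" "Q = set qs"
      "x = Nd (enc_list enc_predicate ps) (enc_list enc_query qs)"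
    unfolding encodes_input_def by blast
  let ?xs = "subtrees (enc_list enc_query qs)" and ?s = "tree_size x"
  let ?Ls = "tuples (length ?xs) ?xs" and ?X = "2 * tree_size x + 20"
  have qs: "tree_size (enc_list enc_query qs) \<le> ?s" by (simp add: in_out)
  then have len: "length ?xs \<le> ?s" using length_subtrees_le le_trans by blast
  have "tree_size (enc_trees ?xs) \<le> 1 + length ?xs * (1 + ?s)"
    using tree_size_subtrees_le qs le_trans by (intro tree_size_enc_list_le) blast
  also have "\<dots> \<le> 1 + ?s * (1 + ?s)" using len by (intro add_mono mult_le_mono) auto
  also have "\<dots> \<le> ?X ^ 2" by (simp add: power2_eq_square algebra_simps)
  finally obtain t where "t \<le> ?X ^ ((2 * length ?xs + 5) * 14)"
      "runs (partner_program (Var 2)) x (enc_list enc_pointed (partner ?Ls ps qs)) t"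
    using runs_partner_program_power[of "Var 2" ps qs "enc_trees ?xs" ?X] len
    by (auto simp: in_out)
  moreover have "?X ^ ((2 * length ?xs + 5) * 14) \<le> 2 ^ poly ([:20, 2:] * [:70, 28:]) ?s"
  proof -
    have "?X ^ ((2 * length ?xs + 5) * 14) \<le> ?X ^ ((2 * ?s + 5) * 14)"
      using len by (intro power_increasing) auto
    \<comment> \<open>Replacing the base \<open>?X\<close> by \<open>2 ^ ?X\<close> turns the power
      into 2 to a polynomial.\<close>
    also have "\<dots> \<le> (2 ^ ?X) ^ ((2 * ?s + 5) * 14)"
      by (intro power_mono less_imp_le[OF less_exp]) simp
    also have "\<dots> = 2 ^ (?X * ((2 * ?s + 5) * 14))" by (rule power_mult[symmetric])
    also have "?X * ((2 * ?s + 5) * 14) = poly ([:20, 2:] * [:70, 28:]) ?s"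
      by (simp add: algebra_simps)
    finally show ?thesis .
  qed
  moreover have "split_partner ELI \<Sigma> Q ((\<lambda>(fs, a). (set fs, a)) ` set (partner ?Ls ps qs))"
    unfolding in_out(1,2) by (rule split_partner_partner, rule ELI_partner_complete) auto
  ultimately show "\<exists>y t \<S>. runs (partner_program (Var 2)) x y t \<and>
      t \<le> 2 ^ poly ([:20, 2:] * [:70, 28:]) (tree_size x) \<and>
      encodes_output \<S> y \<and> split_partner ELI \<Sigma> Q \<S>"
    using encodes_output_partner le_trans by blast
qed

section \<open>A lower bound for inverse roles\<close>

fun conj :: "query list \<Rightarrow> query" where
  "conj [] = Top"
| "conj (q # qs) = And q (conj qs)"

lemma sat_conj [simp]: "sat \<A> (conj qs) a \<longleftrightarrow> (\<forall>q \<in> set qs. sat \<A> q a)"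
  by (induction qs) auto

lemma preds_conj [simp]: "preds (conj qs) = (\<Union>q \<in> set qs. preds q)"
  by (induction qs) auto

lemma query_size_conj: "query_size (conj qs) = 1 + (\<Sum>q\<leftarrow>qs. query_size q + 1)"
  by (induction qs) auto

definition num :: "nat \<Rightarrow> name" where
  "num i = replicate i True"

lemma num_eq_iff [simp]: "num i = num j \<longleftrightarrow> i = j"
  by (metis num_def length_replicate)

text \<open>The two unary symbols with index \<open>i\<close> are named \<open>x # num i\<close> for \<open>x\<close> a Boolean.\<close>

definition both_preds :: "nat \<Rightarrow> query" where
  "both_preds i = And (Ex (Inv []) (Atom (False # num i))) (Ex (Inv []) (Atom (True # num i)))"

definition hard_query :: "nat \<Rightarrow> query" where
  "hard_query n = Ex (Fwd []) (conj (map both_preds [0..<n]))"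

definition hard_signature :: "nat \<Rightarrow> signature" where
  "hard_signature n = insert (Binary []) ((\<lambda>(x, i). Unary (x # num i)) ` (UNIV \<times> {..<n}))"

text \<open>For a set \<open>X\<close> of indices, the root satisfies exactly one of the two symbols of each index,
  and its \<open>j\<close>-th successor lacks only predecessors with the symbols of index \<open>j\<close>. Hence the query
  does not entail \<open>hard_query n\<close>, but its conjunction with such a query for a different set does.\<close>

definition fooling_query :: "nat \<Rightarrow> nat set \<Rightarrow> query" where
  "fooling_query n X = And (conj (map (\<lambda>i. Atom ((i \<in> X) # num i)) [0..<n]))
     (conj (map (\<lambda>j. Ex (Fwd []) (conj (map both_preds (filter (\<lambda>i. i \<noteq> j) [0..<n])))) [0..<n]))"

lemma sat_both_preds [simp]:
  "sat \<A> (both_preds i) b \<longleftrightarrow> (\<forall>x. \<exists>c. BFact [] c b \<in> \<A> \<and> UFact (x # num i) c \<in> \<A>)"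
  by (auto simp: both_preds_def all_bool_eq)

lemma preds_both_preds [simp]:
  "preds (both_preds i) = {Binary [], Unary (False # num i), Unary (True # num i)}"
  by (auto simp: both_preds_def)

lemma sat_hard_query:
  "sat \<A> (hard_query n) a \<longleftrightarrow>
     (\<exists>b. BFact [] a b \<in> \<A> \<and> (\<forall>i<n. \<forall>x. \<exists>c. BFact [] c b \<in> \<A> \<and> UFact (x # num i) c \<in> \<A>))"
  by (auto simp: hard_query_def)

lemma sat_fooling_query:
  "sat \<A> (fooling_query n X) a \<longleftrightarrow> (\<forall>i<n. UFact ((i \<in> X) # num i) a \<in> \<A>) \<and>
     (\<forall>j<n. \<exists>b. BFact [] a b \<in> \<A> \<and>
        (\<forall>i<n. i \<noteq> j \<longrightarrow> (\<forall>x. \<exists>c. BFact [] c b \<in> \<A> \<and> UFact (x # num i) c \<in> \<A>)))"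
  unfolding fooling_query_def by simp (simp add: Ball_def imp_conjL)

lemma hard_query_in_ELI: "hard_query n \<in> ELI (hard_signature n)"
  by (auto simp: ELI_def hard_query_def hard_signature_def)

lemma fooling_query_in_ELI: "fooling_query n X \<in> ELI (hard_signature n)"
  by (auto simp: ELI_def fooling_query_def hard_signature_def image_iff)

lemma query_size_hard_query: "query_size (hard_query n) = 8 * n + 3"
proof -
  have "query_size (conj (map both_preds [0..<n])) = 8 * n + 1"
    unfolding query_size_conj by (induction n) (auto simp: both_preds_def)
  then show ?thesis by (simp add: hard_query_def)
qed

lemma finite_hard_signature: "finite (hard_signature n)"
  by (simp add: hard_signature_def)

lemma card_hard_signature_le: "card (hard_signature n) \<le> 2 * n + 1"
proof -
  have "card ((\<lambda>(x, i). Unary (x # num i)) ` (UNIV \<times> {..<n})) \<le> card ((UNIV :: bool set) \<times> {..<n})"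
    by (rule card_image_le) simp
  then show ?thesis unfolding hard_signature_def by (simp add: card_insert_if)
qed

lemma not_entails_fooling_query: "\<not> entails (fooling_query n X) (hard_query n)"
proof -
  let ?r = "[]" and ?b = "\<lambda>j. False # num j" and ?c = "\<lambda>j. True # num j"
  \<comment> \<open>The root \<open>?r\<close> has the successors \<open>?b j\<close>. The only
    other predecessor of \<open>?b j\<close> is \<open>?c j\<close>, which carries both symbols of
    every index except \<open>j\<close>. The first letter keeps the names \<open>?b j\<close> and
    \<open>?c j\<close> apart.\<close>
  define \<A> where "\<A> = (\<lambda>i. UFact ((i \<in> X) # num i) ?r) ` {..<n} \<union> (\<lambda>j. BFact [] ?r (?b j)) ` {..<n} \<union>
    (\<lambda>j. BFact [] (?c j) (?b j)) ` {..<n} \<union>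
    (\<lambda>(i, j, x). UFact (x # num i) (?c j)) ` {(i, j, x). i < n \<and> j < n \<and> i \<noteq> j}"
  have "{(i, j, x::bool). i < n \<and> j < n \<and> i \<noteq> j} \<subseteq> {..<n} \<times> {..<n} \<times> UNIV" by auto
  then have "finite {(i, j, x::bool). i < n \<and> j < n \<and> i \<noteq> j}" by (rule finite_subset) simp
  then have "data_instance \<A>" by (simp add: data_instance_def \<A>_def)
  moreover have edges: "BFact [] a b \<in> \<A> \<longleftrightarrow> (\<exists>j<n. b = ?b j \<and> (a = ?r \<or> a = ?c j))" for a b
    by (auto simp: \<A>_def)
  have root: "UFact A ?r \<in> \<A> \<longleftrightarrow> (\<exists>i<n. A = (i \<in> X) # num i)" for A by (auto simp: \<A>_def)
  have pred: "UFact A (?c j) \<in> \<A> \<longleftrightarrow> j < n \<and> (\<exists>i<n. i \<noteq> j \<and> (\<exists>x. A = x # num i))" for A j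
    by (auto simp: \<A>_def image_iff)
  have "sat \<A> (fooling_query n X) ?r"
    unfolding sat_fooling_query
  proof (intro conjI allI impI)
    fix i assume "i < n"
    then show "UFact ((i \<in> X) # num i) ?r \<in> \<A>" unfolding root by blast
  next
    fix j assume j: "j < n"
    have "\<exists>c. BFact [] c (?b j) \<in> \<A> \<and> UFact (x # num i) c \<in> \<A>" if "i < n" "i \<noteq> j" for i x
      using that j by (intro exI[of _ "?c j"]) (auto simp: edges pred)
    moreover have "BFact [] ?r (?b j) \<in> \<A>" using j unfolding edges by blast
    ultimately show "\<exists>b. BFact [] ?r b \<in> \<A> \<and>
        (\<forall>i<n. i \<noteq> j \<longrightarrow> (\<forall>x. \<exists>c. BFact [] c b \<in> \<A> \<and> UFact (x # num i) c \<in> \<A>))"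
      by blast
  qed
  moreover have "\<not> sat \<A> (hard_query n) ?r"
  proof
    assume "sat \<A> (hard_query n) ?r"
    then obtain j where j: "j < n"
      "\<And>x. \<exists>c. BFact [] c (?b j) \<in> \<A> \<and> UFact (x # num j) c \<in> \<A>"
      unfolding sat_hard_query edges by auto
    \<comment> \<open>The symbol of index \<open>j\<close> with the Boolean
      \<open>j \<notin> X\<close> is missing at both predecessors of \<open>?b j\<close>: the root
      has the other one, and \<open>?c j\<close> has none of index \<open>j\<close>.\<close>
    from j(2)[of "j \<notin> X"] show False by (auto simp: edges root pred)
  qed
  ultimately show ?thesis by (auto simp: entails_def)
qed

text \<open>If \<open>X\<close> and \<open>Y\<close> differ at \<open>j\<close>, then
  \<open>a\<close> carries both symbols of index \<open>j\<close>. Being itself a predecessor of its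
  \<open>j\<close>-th successor, it supplies exactly what is lacking there.\<close>

lemma sat_two_fooling_queries:
  assumes "sat \<A> (fooling_query n X) a" "sat \<A> (fooling_query n Y) a"
    and "X \<subseteq> {..<n}" "Y \<subseteq> {..<n}" "X \<noteq> Y"
  shows "sat \<A> (hard_query n) a"
proof -
  from assms(3-5) obtain j where j: "j < n" "j \<in> X \<longleftrightarrow> j \<notin> Y" by blast
  have "UFact ((j \<in> X) # num j) a \<in> \<A>" "UFact ((j \<in> Y) # num j) a \<in> \<A>"
    using assms(1,2) j(1) unfolding sat_fooling_query by blast+
  then have root: "UFact (x # num j) a \<in> \<A>" for x using j(2) by (cases x; cases "j \<in> X") auto
  from assms(1) j obtain b where "BFact [] a b \<in> \<A>"
    "\<forall>i<n. i \<noteq> j \<longrightarrow> (\<forall>x. \<exists>c. BFact [] c b \<in> \<A> \<and> UFact (x # num i) c \<in> \<A>)"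
    unfolding sat_fooling_query by blast
  with root show ?thesis unfolding sat_hard_query by metis
qed

lemma total_size_hard_query:
  assumes S: "split_partner ELI (hard_signature n) {hard_query n} \<S>" and "n > 0"
  shows "2 ^ n \<le> total_size \<S>"
proof -
  have sat_iff: "(\<exists>(\<A>, a) \<in> \<S>. sat \<A> q' a) \<longleftrightarrow> \<not> entails q' (hard_query n)"
    if "q' \<in> ELI (hard_signature n)" for q'
    using S that by (simp add: split_partner_def)
  have fin: "finite \<S>" "\<And>\<A> a. (\<A>, a) \<in> \<S> \<Longrightarrow> finite \<A>"
    using S by (auto simp: split_partner_def data_instance_over_def data_instance_def)
  have "\<forall>X. \<exists>s. s \<in> \<S> \<and> sat (fst s) (fooling_query n X) (snd s)"
    using sat_iff[OF fooling_query_in_ELI] not_entails_fooling_query by fastforce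
  then obtain f where f: "\<And>X. f X \<in> \<S>" "\<And>X. sat (fst (f X)) (fooling_query n X) (snd (f X))"
    by metis
  \<comment> \<open>The hard query entails itself, so no member of a split partner satisfies
    it.\<close>
  have not_sat: "\<not> sat (fst s) (hard_query n) (snd s)" if "s \<in> \<S>" for s
    using sat_iff[OF hard_query_in_ELI] that by (force simp: entails_def)
  have "inj_on f (Pow {..<n})"
  proof (rule inj_onI)
    fix X Y assume *: "X \<in> Pow {..<n}" "Y \<in> Pow {..<n}" "f X = f Y"
    show "X = Y"
    proof (rule ccontr)
      assume "X \<noteq> Y"
      then have "sat (fst (f X)) (hard_query n) (snd (f X))"
        using * f(2)[of X] f(2)[of Y] by (intro sat_two_fooling_queries[of _ n X _ Y]) auto
      then show False using not_sat f(1) by blast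
    qed
  qed
  then have "2 ^ n = card (f ` Pow {..<n})" by (simp add: card_image card_Pow)
  also have "\<dots> = (\<Sum>s \<in> f ` Pow {..<n}. 1)" by simp
  also have "\<dots> \<le> (\<Sum>s \<in> f ` Pow {..<n}. card (fst s))"
  proof (rule sum_mono)
    fix s assume "s \<in> f ` Pow {..<n}"
    then obtain X where X: "s = f X" by blast
    \<comment> \<open>For \<open>n > 0\<close> the fooling query requires a unary fact at the root,
      so each of the \<open>2 ^ n\<close> members counts at least 1.\<close>
    have "fst s \<noteq> {}" using f(2)[of X] \<open>n > 0\<close> unfolding X sat_fooling_query by auto
    moreover have "finite (fst s)" using fin(2)[of "fst s" "snd s"] f(1) X by simp
    ultimately show "1 \<le> card (fst s)" by (simp add: Suc_le_eq card_gt_0_iff)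
  qed
  also have "\<dots> \<le> (\<Sum>s \<in> \<S>. card (fst s))"
    using fin(1) f(1) by (intro sum_mono2) auto
  finally show ?thesis by (simp add: total_size_def case_prod_unfold)
qed

section \<open>Polynomials against powers of two\<close>

text \<open>One Horner step replaces \<open>c\<close> by \<open>a + c\<close> and increases
  \<open>d\<close> by 1. The base \<open>m + 1\<close> keeps all powers at least 1, which takes care
  of the constant \<open>a\<close>.\<close>

lemma poly_nat_le_power:
  fixes f :: "nat poly"
  shows "\<exists>c d. \<forall>m. poly f m \<le> c * (m + 1) ^ d"
proof (induction f)
  case 0
  then show ?case by auto
next
  case (pCons a f)
  then obtain c d where cd: "\<And>m. poly f m \<le> c * (m + 1) ^ d" by blast
  have "poly (pCons a f) m \<le> (a + c) * (m + 1) ^ Suc d" for m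
  proof -
    have "m * poly f m \<le> (m + 1) * (c * (m + 1) ^ d)" using cd by (intro mult_mono) auto
    moreover have "1 \<le> (m + 1) ^ Suc d" by (rule one_le_power) simp
    then have "a * 1 \<le> a * (m + 1) ^ Suc d" by (rule mult_le_mono2)
    ultimately show ?thesis by (simp add: algebra_simps)
  qed
  then show ?case by blast
qed

lemma poly_nat_mono: "m \<le> m' \<Longrightarrow> poly f m \<le> poly (f :: nat poly) m'"
  by (induction f) (auto intro: add_mono mult_mono)

lemma exists_poly_less_two_power:
  fixes f :: "nat poly"
  shows "\<exists>n>0. poly f (10 * n + 4) < 2 ^ n"
proof -
  obtain c d where cd: "\<And>m. poly f m \<le> c * (m + 1) ^ d" using poly_nat_le_power by blast
  \<comment> \<open>\<open>k\<close> is chosen so that \<open>c < 2 ^ k\<close> and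
    \<open>k + (4 + 2 * k) * d \<le> k * k\<close>. With \<open>n = 2 ^ (2 * k)\<close>, the
    polynomial is below 2 to the left-hand side, and \<open>k * k \<le> n\<close>.\<close>
  define k where "k = c + 5 * d + 5"
  have "k < 2 ^ k" by (rule less_exp)
  then have "c < 2 ^ k" unfolding k_def by linarith
  define n :: nat where "n = 2 ^ (2 * k)"
  have n_pos: "n \<ge> 1" by (simp add: n_def)
  have sq: "n = 2 ^ k * 2 ^ k" by (simp add: n_def power_add[symmetric] mult_2)
  have "poly f (10 * n + 4) \<le> c * (10 * n + 4 + 1) ^ d" by (rule cd)
  also have "\<dots> \<le> c * (2 ^ 4 * n) ^ d"
    using n_pos by (intro mult_left_mono power_mono) auto
  also have "\<dots> < 2 ^ k * (2 ^ 4 * n) ^ d"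
    using \<open>c < 2 ^ k\<close> n_pos by (intro mult_strict_right_mono) auto
  also have "\<dots> = 2 ^ (k + (4 + 2 * k) * d)"
    unfolding n_def power_add[symmetric] power_mult[symmetric] by (rule refl)
  also have "\<dots> \<le> 2 ^ n"
  proof (rule power_increasing)
    have "k + (4 + 2 * k) * d \<le> k + 4 * k + 2 * (k * d)"
      by (simp add: k_def algebra_simps)
    also have "\<dots> \<le> k * k"
      by (simp add: k_def algebra_simps)
    also have "\<dots> \<le> n" unfolding sq using \<open>k < 2 ^ k\<close> by (intro mult_mono) auto
    finally show "k + (4 + 2 * k) * d \<le> n" .
  qed simp
  finally show ?thesis by (intro exI[of _ n]) (simp add: n_def)
qed

lemma no_polynomial_split_partners:
  "\<not> (\<exists>f :: nat poly. \<forall>\<Sigma> q. is_signature \<Sigma> \<and> q \<in> ELI \<Sigma> \<longrightarrow>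
      (\<exists>\<S>. split_partner ELI \<Sigma> {q} \<S> \<and> total_size \<S> \<le> poly f (query_size q + card \<Sigma>)))"
proof
  assume "\<exists>f :: nat poly. \<forall>\<Sigma> q. is_signature \<Sigma> \<and> q \<in> ELI \<Sigma> \<longrightarrow>
      (\<exists>\<S>. split_partner ELI \<Sigma> {q} \<S> \<and> total_size \<S> \<le> poly f (query_size q + card \<Sigma>))"
  then obtain f :: "nat poly" where f: "\<And>\<Sigma> q. is_signature \<Sigma> \<Longrightarrow> q \<in> ELI \<Sigma> \<Longrightarrow>
      \<exists>\<S>. split_partner ELI \<Sigma> {q} \<S> \<and> total_size \<S> \<le> poly f (query_size q + card \<Sigma>)"
    by blast
  obtain n where n: "n > 0" "poly f (10 * n + 4) < 2 ^ n" using exists_poly_less_two_power by blast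
  have "is_signature (hard_signature n)"
    using finite_hard_signature by (auto simp: is_signature_def hard_signature_def)
  from f[OF this hard_query_in_ELI] obtain \<S> where
    "split_partner ELI (hard_signature n) {hard_query n} \<S>"
    "total_size \<S> \<le> poly f (query_size (hard_query n) + card (hard_signature n))" by blast
  then have "2 ^ n \<le> poly f (query_size (hard_query n) + card (hard_signature n))"
    using total_size_hard_query n(1) le_trans by blast
  \<comment> \<open>The query has size \<open>8 * n + 3\<close> and the signature at most
    \<open>2 * n + 1\<close> symbols.\<close>
  also have "\<dots> \<le> poly f (10 * n + 4)"
    using card_hard_signature_le[of n] by (intro poly_nat_mono) (simp add: query_size_hard_query)
  finally show False using n(2) by simp
qed

theorem theorem30:
  "(\<forall>n>0. \<exists>(p :: program) (f :: nat poly).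
      computes_split_partners EL (\<lambda>Q. card Q \<le> n) (\<lambda>m. poly f m) p) \<and>
   (\<exists>(p :: program) (f :: nat poly).
      computes_split_partners ELI (\<lambda>Q. True) (\<lambda>m. 2 ^ poly f m) p) \<and>
   \<not> (\<exists>f :: nat poly. \<forall>\<Sigma> q. is_signature \<Sigma> \<and> q \<in> ELI \<Sigma> \<longrightarrow>
      (\<exists>\<S>. split_partner ELI \<Sigma> {q} \<S> \<and> total_size \<S> \<le> poly f (query_size q + card \<Sigma>)))"
proof (intro conjI)
  show "\<forall>n>0. \<exists>(p :: program) (f :: nat poly).
      computes_split_partners EL (\<lambda>Q. card Q \<le> n) (\<lambda>m. poly f m) p"
    using EL_split_partners by blast
  show "\<exists>(p :: program) (f :: nat poly).
      computes_split_partners ELI (\<lambda>Q. True) (\<lambda>m. 2 ^ poly f m) p"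
    using ELI_split_partners by blast
qed (rule no_polynomial_split_partners)

end
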